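(* Let $\mathrm{Z}$ be a densely defined linear operator in a Banach space $\mathbf{X}$ and let $t>0$. Assume that there exists a function $\mathrm{F}\in\mathcal{F}_{\mathbf{X}}$ such that $\mathcal{D}(\mathrm{F}'(0))\supset\mathcal{D}(\mathrm{Z})$ and $\mathrm{F}'(0)f=\mathrm{Z}f$ for $f\in\mathcal{D}(\mathrm{Z})$. Then $\mathrm{Z}$ is closable and its closure is a generator of a $C_0$-semigroup if and only if there exists a dense linear subspace $\mathbf{A}\subseteq\mathcal{D}(\mathrm{Z})$ (dense in $\mathbf{X}$) such that for all $f\in\mathbf{A}$, $s\ge 0$ there exists a sequence $\{f_n^s\}_{n=1}^\infty$, $f_n^s\in\mathcal{D}(\mathrm{Z})$, satisfying the following conditions: (a) $\lim_{n\to\infty}\|\mathrm{F}(t/n)^{[ns]}f-f_n^s\|=0$; (b) the sets $\{\mathrm{Z}f_n^s\}_{n=1}^\infty$ and $\{f_n^s\}_{n=1}^\infty$ are precompact.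
   Context: $\mathcal{L}(\mathbf{X})$ is the space of bounded linear operators on the Banach space $\mathbf{X}$ (over $\mathbb{R}$ or $\mathbb{C}$). For $\mathrm{S}:[0,\infty)\to\mathcal{L}(\mathbf{X})$, the (strong) derivative at $0$ is the linear operator $\mathrm{S}'(0)\psi=\lim_{h\to 0}h^{-1}(\mathrm{S}(h)\psi-\mathrm{S}(0)\psi)$ (norm limit, $h>0$), whose domain $\mathcal{D}(\mathrm{S}'(0))$ is the set of all $\psi\in\mathbf{X}$ for which the limit exists. $\mathcal{F}_{\mathbf{X}}$ is the set of all functions $\mathrm{F}:[0,\infty)\to\mathcal{L}(\mathbf{X})$ such that $\mathrm{F}(0)=\mathrm{I}$, there exist $M\ge 1$, $a\in\mathbb{R}$ with $\|\mathrm{F}(s/n)^m\|\le M\exp(\frac{am}{n}s)$ for all $n,m\in\mathbb{N}$, $s\ge 0$, and $\mathcal{D}(\mathrm{F}'(0))$ is dense in $\mathbf{X}$. The function $\mathrm{F}$ in (a) is the one given by the assumption. $[x]$ is the integer part of $x$; precompact means relatively compact in the norm topology. *)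

theory Defs
  imports "HOL-Analysis.Analysis"
begin

text \<open>
  A Banach space over a scalar field \<open>'k\<close>. By Gelfand--Mazur the type class
  \<^class>\<open>real_normed_field\<close> (multiplicative norm) covers exactly the real and the complex
  numbers up to isometric isomorphism, so \<open>'k = real\<close> (with \<open>smul = scaleR\<close>) and
  \<open>'k = complex\<close> are the two cases. Completeness and the underlying real structure come
  from the class \<^class>\<open>banach\<close>.
\<close>

locale banach_space_over = vector_space smul
  for smul :: "'k::real_normed_field \<Rightarrow> 'x::banach \<Rightarrow> 'x" +
  assumes norm_scale: "norm (smul c x) = norm c * norm x"
    and scale_of_real: "smul (of_real r) x = r *\<^sub>R x"

definition bounded_operator ::
    "('k::real_normed_field \<Rightarrow> 'x::banach \<Rightarrow> 'x) \<Rightarrow> ('x \<Rightarrow> 'x) \<Rightarrow> bool" where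
  "bounded_operator smul B \<longleftrightarrow> Vector_Spaces.linear smul smul B \<and> bounded_linear B"

text \<open>
  An unbounded operator is given by its domain \<open>D\<close> and a function \<open>Z\<close> whose values outside
  \<open>D\<close> are irrelevant.
\<close>

definition linear_operator ::
    "('k::real_normed_field \<Rightarrow> 'x::banach \<Rightarrow> 'x) \<Rightarrow> 'x set \<Rightarrow> ('x \<Rightarrow> 'x) \<Rightarrow> bool" where
  "linear_operator smul D Z \<longleftrightarrow>
     module.subspace smul D \<and>
     (\<forall>x\<in>D. \<forall>y\<in>D. Z (x + y) = Z x + Z y) \<and>
     (\<forall>c. \<forall>x\<in>D. Z (smul c x) = smul c (Z x))"

definition operator_graph :: "'x set \<Rightarrow> ('x \<Rightarrow> 'x) \<Rightarrow> ('x \<times> 'x) set" where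
  "operator_graph D Z = {(x, Z x) | x. x \<in> D}"

definition is_closure_of ::
    "'x::banach set \<Rightarrow> ('x \<Rightarrow> 'x) \<Rightarrow> 'x set \<Rightarrow> ('x \<Rightarrow> 'x) \<Rightarrow> bool" where
  "is_closure_of D' Z' D Z \<longleftrightarrow> operator_graph D' Z' = closure (operator_graph D Z)"

definition closable ::
    "('k::real_normed_field \<Rightarrow> 'x::banach \<Rightarrow> 'x) \<Rightarrow> 'x set \<Rightarrow> ('x \<Rightarrow> 'x) \<Rightarrow> bool" where
  "closable smul D Z \<longleftrightarrow> (\<exists>D' Z'. linear_operator smul D' Z' \<and> is_closure_of D' Z' D Z)"

text \<open>
  Operator families on \<open>[0, \<infinity>)\<close> are functions on all of \<^typ>\<open>real\<close>; only their values at
  nonnegative arguments are ever used.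
\<close>

definition deriv0_domain :: "(real \<Rightarrow> 'x::banach \<Rightarrow> 'x) \<Rightarrow> 'x set" where
  "deriv0_domain S = {x. \<exists>y. ((\<lambda>h. (S h x - S 0 x) /\<^sub>R h) \<longlongrightarrow> y) (at_right 0)}"

definition deriv0 :: "(real \<Rightarrow> 'x::banach \<Rightarrow> 'x) \<Rightarrow> 'x \<Rightarrow> 'x" where
  "deriv0 S x = Lim (at_right 0) (\<lambda>h. (S h x - S 0 x) /\<^sub>R h)"

definition C0_semigroup ::
    "('k::real_normed_field \<Rightarrow> 'x::banach \<Rightarrow> 'x) \<Rightarrow> (real \<Rightarrow> 'x \<Rightarrow> 'x) \<Rightarrow> bool" where
  "C0_semigroup smul T \<longleftrightarrow>
     (\<forall>s\<ge>0. bounded_operator smul (T s)) \<and>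
     T 0 = id \<and>
     (\<forall>r\<ge>0. \<forall>s\<ge>0. T (r + s) = T r \<circ> T s) \<and>
     (\<forall>x. ((\<lambda>s. T s x) \<longlongrightarrow> x) (at_right 0))"

definition is_generator ::
    "('k::real_normed_field \<Rightarrow> 'x::banach \<Rightarrow> 'x) \<Rightarrow> 'x set \<Rightarrow> ('x \<Rightarrow> 'x) \<Rightarrow> bool" where
  "is_generator smul D G \<longleftrightarrow>
     (\<exists>T. C0_semigroup smul T \<and> D = deriv0_domain T \<and> (\<forall>x\<in>D. G x = deriv0 T x))"

definition F_class ::
    "('k::real_normed_field \<Rightarrow> 'x::banach \<Rightarrow> 'x) \<Rightarrow> (real \<Rightarrow> 'x \<Rightarrow> 'x) set" where
  "F_class smul = {F.
     (\<forall>s\<ge>0. bounded_operator smul (F s)) \<and>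
     F 0 = id \<and>
     (\<exists>M a. M \<ge> 1 \<and>
        (\<forall>n\<ge>1. \<forall>m\<ge>1. \<forall>s\<ge>0.
           onorm (F (s / real n) ^^ m) \<le> M * exp (a * real m / real n * s))) \<and>
     closure (deriv0_domain F) = UNIV}"

end

theory Submission
  imports Defs
begin

text \<open>
  Stability and consistency give, for \<open>(x, y)\<close> in the closure \<open>\<Gamma>\<close> of the graph of \<open>Z\<close>, the
  estimate \<open>F \<tau> ^^ m x = x + m \<tau> y + o(m \<tau>)\<close> for small \<open>m \<tau>\<close>, uniformly in \<open>\<tau>\<close> as
  \<open>\<tau> \<rightarrow> 0\<close> and uniformly for \<open>y\<close> in compact sets.

  If \<open>\<Gamma>\<close> is the graph of the generator of a semigroup \<open>T\<close>, the same estimate holds for \<open>T\<close>, and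
  telescoping yields Chernoff's product formula. One takes \<open>A = D\<close> and lets \<open>(f_n, Z f_n)\<close> be a
  sequence converging in \<open>\<Gamma>\<close> to \<open>T(t s) f\<close> and its image under the generator.

  Conversely, Tychonoff's theorem provides a filter finer than \<open>n \<rightarrow> \<infinity>\<close> along which all the
  sequences in (a) and (b) converge. The limit of \<open>F (t/n) ^^ [ns]\<close> along it is a \<open>C\<^sub>0\<close>-semigroup
  whose generator extends \<open>\<Gamma>\<close> by the estimate; so \<open>Z\<close> is closable. By (b) the orbits through \<open>A\<close>
  stay in the domain of the closure, and Riemann sums of them show that it is a core, so the
  generator is exactly \<open>\<Gamma>\<close>. Neither resolvents nor vector-valued integrals are needed.
\<close>

section \<open>Uniform boundedness, precompactness and convergent subfilters\<close>

text \<open>Baire category: the closed sets \<open>E k\<close> cover the space, so one of them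
  contains a ball, and every small vector is a difference of two points of that ball. It serves to
  bound a semigroup near time zero.\<close>

lemma uniform_boundedness:
  fixes B :: "nat \<Rightarrow> 'a::banach \<Rightarrow> 'b::real_normed_vector"
  assumes lin: "\<And>n. bounded_linear (B n)" and bdd: "\<And>x. \<exists>c. \<forall>n. norm (B n x) \<le> c"
  shows "\<exists>C. \<forall>n x. norm (B n x) \<le> C * norm x"
proof -
  define E where "E k = (\<Inter>n. {x. norm (B n x) \<le> real k})" for k :: nat
  have closed: "closed (E k)" for k
    unfolding E_def
    by (intro closed_INT ballI closed_Collect_le continuous_intros
        linear_continuous_on[OF lin, folded continuous_on_eq_continuous_within])
  have "x \<in> \<Union>(range E)" for x
  proof -
    obtain c where c: "\<And>n. norm (B n x) \<le> c" using bdd by blast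
    obtain k :: nat where "c \<le> real k" using real_arch_simple by blast
    then have "x \<in> E k" using c by (auto simp: E_def intro: order_trans)
    then show ?thesis by blast
  qed
  then have cover: "\<Union>(range E) = UNIV" by blast
  have "\<exists>k. interior (E k) \<noteq> {}"
  proof (rule ccontr)
    assume "\<not> (\<exists>k. interior (E k) \<noteq> {})"
    then have "euclidean interior_of \<Union>(range E) = {}"
      using closed
      by (intro Baire_category_alt disjI1 completely_metrizable_space_euclidean) auto
    then show False by (simp add: cover)
  qed
  then obtain k x0 where "x0 \<in> interior (E k)" by blast
  then obtain r where r: "r > 0" "cball x0 r \<subseteq> E k"
    unfolding mem_interior_cball by blast
  have "norm (B n x) \<le> 2 * real k / r * norm x" for n x
  proof (cases "x = 0")
    case False
    interpret bounded_linear "B n" by (rule lin)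
    define y where "y = (r / norm x) *\<^sub>R x"
    have "x0 \<in> E k" "x0 + y \<in> E k"
      using r False by (auto simp: y_def dist_norm)
    then have "norm (B n x0) \<le> real k" "norm (B n (x0 + y)) \<le> real k"
      by (auto simp: E_def)
    moreover have "norm (B n y) \<le> norm (B n (x0 + y)) + norm (B n x0)"
      using norm_triangle_ineq4[of "B n (x0 + y)" "B n x0"] by (simp add: add)
    ultimately have "norm (B n y) \<le> 2 * real k" by linarith
    then show ?thesis using r(1) False by (simp add: y_def scaleR field_simps)
  qed (simp add: linear_0 bounded_linear.linear[OF lin])
  then show ?thesis by blast
qed

text \<open>An infinite subset of the sequence with its limit must accumulate at the limit, as every
  neighbourhood of the limit misses only finitely many terms. This turns convergence into condition
  (b).\<close>

lemma compact_closure_convergent: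
  fixes f :: "nat \<Rightarrow> 'a::metric_space"
  assumes "f \<longlonglongrightarrow> l"
  shows "compact (closure (f ` N))"
proof -
  have "compact (insert l (range f))"
    unfolding compact_eq_Bolzano_Weierstrass
  proof (intro allI impI)
    fix T assume T: "infinite T \<and> T \<subseteq> insert l (range f)"
    have "l islimpt T"
    proof (rule islimptI)
      fix U assume U: "l \<in> U" "open U"
      then obtain n0 where n0: "\<And>n. n \<ge> n0 \<Longrightarrow> f n \<in> U"
        using assms by (metis topological_tendstoD eventually_sequentially)
      have "infinite (T - insert l (f ` {..<n0}))" using T by simp
      then obtain y where "y \<in> T" "y \<notin> insert l (f ` {..<n0})"
        by (metis Diff_iff finite.emptyI equals0I)
      moreover from this obtain n where "y = f n" using T by blast
      ultimately have "y \<in> U" using n0 by (metis imageI insertCI lessThan_iff linorder_not_less)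
      then show "\<exists>y\<in>T. y \<in> U \<and> y \<noteq> l" using \<open>y \<in> T\<close> \<open>y \<notin> _\<close> by blast
    qed
    then show "\<exists>x\<in>insert l (range f). x islimpt T" by blast
  qed
  moreover from this have "closure (f ` N) \<subseteq> insert l (range f)"
    by (intro closure_minimal compact_imp_closed) auto
  ultimately show ?thesis
    by (metis closed_closure compact_Int_closed inf.absorb2)
qed

text \<open>The index set may be uncountable, so a diagonal sequence cannot serve. By Tychonoff the
  functions \<open>g n\<close> have a cluster point \<open>p\<close> in the product, and refining
  \<open>G\<close> by the preimages of the neighbourhoods of \<open>p\<close> gives convergence in
  all coordinates at once.\<close>

lemma pointwise_convergent_subfilter:
  fixes g :: "'n \<Rightarrow> 'i \<Rightarrow> 'b::topological_space"
  assumes G: "G \<noteq> bot" and K: "\<And>i. compact (K i)" and gK: "\<forall>\<^sub>F n in G. \<forall>i. g n i \<in> K i"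
  obtains H where "H \<le> G" "H \<noteq> bot" "\<And>i. \<exists>l. ((\<lambda>n. g n i) \<longlongrightarrow> l) H"
proof -
  have "compact (PiE UNIV K)"
    using compactin_PiE[of "\<lambda>_. euclidean" UNIV K] K
    by (simp add: euclidean_product_topology)
  moreover have "filtermap g G \<noteq> bot" using G by (simp add: filtermap_bot_iff)
  moreover have "\<forall>\<^sub>F p in filtermap g G. p \<in> PiE UNIV K"
    using gK by (simp add: eventually_filtermap PiE_iff)
  ultimately obtain p where p: "inf (nhds p) (filtermap g G) \<noteq> bot"
    unfolding compact_filter by blast
  define H where "H = inf (filtercomap g (nhds p)) G"
  \<comment> \<open>If \<open>H\<close> were trivial, \<open>g\<close> would eventually avoid some
    neighbourhood of the cluster point \<open>p\<close>.\<close>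
  have "H \<noteq> bot"
  proof
    assume "H = bot"
    then obtain P Q where PQ: "eventually P (nhds p)" "eventually Q G" "\<And>n. P (g n) \<Longrightarrow> \<not> Q n"
      unfolding trivial_limit_def H_def eventually_inf eventually_filtercomap by blast
    have "eventually (\<lambda>q. \<not> P q) (filtermap g G)"
      using PQ(2) unfolding eventually_filtermap by eventually_elim (use PQ(3) in blast)
    then have "eventually (\<lambda>_. False) (inf (nhds p) (filtermap g G))"
      using PQ(1) unfolding eventually_inf by blast
    then show False using p by (simp add: trivial_limit_def)
  qed
  have "filterlim g (nhds p) H"
    unfolding H_def by (rule filterlim_mono[OF filterlim_filtercomap]) auto
  then have "((\<lambda>n. g n i) \<longlongrightarrow> p i) H" for i
    using continuous_on_tendsto_compose[OF continuous_on_product_coordinates, of g p H] by simp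
  then show ?thesis using that[of H] \<open>H \<noteq> bot\<close> by (auto simp: H_def)
qed

section \<open>Stable families consistent with an operator\<close>

lemma bounded_linear_funpow:
  fixes f :: "'a::real_normed_vector \<Rightarrow> 'a"
  assumes "bounded_linear f"
  shows "bounded_linear (f ^^ m)"
proof (induction m)
  case 0
  have "f ^^ 0 = (\<lambda>x. x)" by (simp add: fun_eq_iff)
  then show ?case by (simp only: bounded_linear_ident)
next
  case (Suc m)
  then show ?case using bounded_linear_compose[OF assms] by (simp add: comp_def)
qed

lemma of_nat_mult_le_trans:
  fixes \<tau> :: real
  assumes "i \<le> m" "0 < \<tau>" "real m * \<tau> \<le> S"
  shows "real i * \<tau> \<le> S"
  by (meson assms less_imp_le mult_right_mono of_nat_mono order_trans)

lemma graph_in_closure: "x \<in> D \<Longrightarrow> (x, Z x) \<in> closure (operator_graph D Z)"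
  by (rule subsetD[OF closure_subset]) (auto simp: operator_graph_def)

text \<open>Both the given approximating family and the semigroup are instances, so each estimate is
  proved once. Stability is local in the total time \<open>real m * \<tau>\<close>, with a constant
  that depends on the horizon \<open>S\<close> alone.\<close>

locale stable_family =
  fixes F :: "real \<Rightarrow> 'x::banach \<Rightarrow> 'x" and D :: "'x set" and Z :: "'x \<Rightarrow> 'x"
  assumes lin: "\<And>\<tau>. 0 < \<tau> \<Longrightarrow> bounded_linear (F \<tau>)"
    and stable: "\<And>S. \<exists>K\<ge>1. \<forall>\<tau>>0. \<forall>m x. real m * \<tau> \<le> S \<longrightarrow> norm ((F \<tau> ^^ m) x) \<le> K * norm x"
    and consistent: "\<And>x. x \<in> D \<Longrightarrow> ((\<lambda>\<tau>. (F \<tau> x - x) /\<^sub>R \<tau>) \<longlongrightarrow> Z x) (at_right 0)"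
    and dense: "closure D = UNIV"
begin

lemma lin_pow: "0 < \<tau> \<Longrightarrow> bounded_linear (F \<tau> ^^ m)"
  by (intro bounded_linear_funpow lin)

lemma pow_diff: "0 < \<tau> \<Longrightarrow> (F \<tau> ^^ m) (x - y) = (F \<tau> ^^ m) x - (F \<tau> ^^ m) y"
  by (intro bounded_linear.linear linear_diff lin_pow)

lemma displacement_perturb:
  assumes "0 < \<tau>" "norm ((F \<tau> ^^ i) (z - z')) \<le> K * norm (z - z')"
  shows "norm ((F \<tau> ^^ i) z - z) \<le> (K + 1) * norm (z - z') + norm ((F \<tau> ^^ i) z' - z')"
proof -
  have "(F \<tau> ^^ i) z - z = (F \<tau> ^^ i) (z - z') + (z' - z) + ((F \<tau> ^^ i) z' - z')"
    using assms(1) by (simp add: pow_diff)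
  also have "norm \<dots> \<le> K * norm (z - z') + norm (z - z') + norm ((F \<tau> ^^ i) z' - z')"
    using assms(2) by (intro norm_triangle_mono) (auto simp: norm_minus_commute)
  finally show ?thesis by (simp add: algebra_simps)
qed

lemma stableE:
  obtains K where "K \<ge> 1"
    "\<And>\<tau> m x. 0 < \<tau> \<Longrightarrow> real m * \<tau> \<le> S \<Longrightarrow> norm ((F \<tau> ^^ m) x) \<le> K * norm x"
  using stable[of S] by blast

text \<open>Telescoping: each further step adds \<tau> times a power of \<open>F \<tau>\<close>
  applied to the difference quotient, which is \<open>v\<close> up to a small error. The reference
  vector \<open>w\<close> is kept apart from \<open>v\<close> so that it can be \<open>0\<close> for
  a crude bound or a limit of values of \<open>Z\<close> for a sharp one.\<close>

lemma increment_bound: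
  assumes \<tau>: "0 < \<tau>"
    and K: "\<And>i y. i < m \<Longrightarrow> norm ((F \<tau> ^^ i) y) \<le> K * norm y"
    and e: "\<And>i. i < m \<Longrightarrow> norm ((F \<tau> ^^ i) v - w) \<le> e"
  shows "norm ((F \<tau> ^^ m) x - x - (real m * \<tau>) *\<^sub>R w)
           \<le> real m * \<tau> * (K * norm ((F \<tau> x - x) /\<^sub>R \<tau> - v) + e)"
  using K e
proof (induction m)
  case (Suc m)
  interpret P: bounded_linear "F \<tau> ^^ m" using \<tau> by (rule lin_pow)
  define d where "d = (F \<tau> x - x) /\<^sub>R \<tau> - v"
  have "(F \<tau> ^^ Suc m) x = (F \<tau> ^^ m) (F \<tau> x)" by (simp add: funpow_swap1)
  also have "F \<tau> x = x + \<tau> *\<^sub>R (d + v)" using \<tau> by (simp add: d_def)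
  also have "(F \<tau> ^^ m) (x + \<tau> *\<^sub>R (d + v)) =
      (F \<tau> ^^ m) x + \<tau> *\<^sub>R ((F \<tau> ^^ m) d + (F \<tau> ^^ m) v)"
    by (simp add: P.add P.scaleR)
  finally have "(F \<tau> ^^ Suc m) x - x - (real (Suc m) * \<tau>) *\<^sub>R w =
      ((F \<tau> ^^ m) x - x - (real m * \<tau>) *\<^sub>R w)
      + \<tau> *\<^sub>R ((F \<tau> ^^ m) d + ((F \<tau> ^^ m) v - w))"
    by (simp add: algebra_simps)
  also have "norm \<dots> \<le> real m * \<tau> * (K * norm d + e) + \<tau> * (K * norm d + e)"
  proof (rule norm_triangle_mono)
    show "norm ((F \<tau> ^^ m) x - x - (real m * \<tau>) *\<^sub>R w) \<le> real m * \<tau> * (K * norm d + e)"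
      using Suc by (simp add: d_def)
    have "norm ((F \<tau> ^^ m) d + ((F \<tau> ^^ m) v - w)) \<le> K * norm d + e"
      using Suc.prems by (intro norm_triangle_mono) auto
    then show "norm (\<tau> *\<^sub>R ((F \<tau> ^^ m) d + ((F \<tau> ^^ m) v - w))) \<le> \<tau> * (K * norm d + e)"
      using \<tau> by simp
  qed
  finally show ?case by (simp add: d_def algebra_simps)
qed simp

lemma consistentE:
  assumes "x \<in> D" "e > 0"
  shows "\<forall>\<^sub>F \<tau> in at_right 0. norm ((F \<tau> x - x) /\<^sub>R \<tau> - Z x) < e"
  using tendstoD[OF consistent, OF assms] by (simp add: dist_norm)

text \<open>For points of \<open>D\<close> and short times the displacement is at most a constant
  times the elapsed time, by consistency and stability; density and stability carry smallness over
  to every \<open>z\<close>.\<close>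

lemma equicontinuous:
  assumes e: "e > 0"
  shows "\<forall>\<^sub>F \<eta> in at_right 0. \<forall>\<tau>>0. \<forall>i. real i * \<tau> \<le> \<eta> \<longrightarrow> norm ((F \<tau> ^^ i) z - z) \<le> e"
proof -
  obtain K where K: "K \<ge> 1"
    "\<And>\<tau> m x. 0 < \<tau> \<Longrightarrow> real m * \<tau> \<le> 1 \<Longrightarrow> norm ((F \<tau> ^^ m) x) \<le> K * norm x"
    using stableE[of 1] by blast
  have "z \<in> closure D" by (simp add: dense)
  moreover have "e / (4 * K) > 0" using e K by simp
  ultimately obtain z' where z': "z' \<in> D" "norm (z' - z) < e / (4 * K)"
    unfolding closure_approachable dist_norm by blast
  obtain b where b: "b > 0"
    "\<And>\<tau>. 0 < \<tau> \<Longrightarrow> \<tau> < b \<Longrightarrow> norm ((F \<tau> z' - z') /\<^sub>R \<tau> - Z z') < 1"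
    using consistentE[OF z'(1), of 1] unfolding eventually_at_right_field by auto
  define c where "c = K * (1 + norm (Z z'))"
  have c: "c > 0" using K(1) by (simp add: c_def add_pos_nonneg)
  \<comment> \<open>The three entries keep the elapsed time within the stability horizon
    \<open>1\<close>, the step size within the range of consistency, and the displacement of
    \<open>z'\<close> below \<open>e / 2\<close>.\<close>
  define \<eta>0 where "\<eta>0 = Min {1, b, e / (2 * c)}"
  have \<eta>0: "\<eta>0 > 0" "\<eta>0 \<le> 1" "\<eta>0 \<le> b" "\<eta>0 \<le> e / (2 * c)"
    using b e c by (auto simp: \<eta>0_def)
  have "norm ((F \<tau> ^^ i) z - z) \<le> e" if \<tau>: "\<tau> > 0" "real i * \<tau> \<le> \<eta>" and \<eta>: "\<eta> < \<eta>0" for \<eta> \<tau> i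
  proof (cases "i = 0")
    case False
    \<comment> \<open>If at least one step is taken, a step is no longer than the elapsed time, so
      the bound on the latter forces \<tau> to be small too.\<close>
    have "1 * \<tau> \<le> real i * \<tau>" using False \<tau> by (intro mult_right_mono) auto
    then have \<tau>b: "\<tau> < b" using \<tau> \<eta> \<eta>0 by linarith
    have i1: "real j * \<tau> \<le> 1" if "j \<le> i" for j
      using of_nat_mult_le_trans[OF that \<tau>] \<eta> \<eta>0 by simp
    have "norm ((F \<tau> ^^ i) z' - z' - (real i * \<tau>) *\<^sub>R 0)
        \<le> real i * \<tau> * (K * norm ((F \<tau> z' - z') /\<^sub>R \<tau> - Z z') + K * norm (Z z'))"
      using K(2)[OF \<tau>(1)] i1 by (intro increment_bound \<tau>) auto
    also have "\<dots> \<le> \<eta>0 * c"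
      using b(2)[OF \<tau>(1) \<tau>b] K(1) \<tau> \<eta> \<eta>0 c unfolding c_def
      by (intro mult_mono) (auto simp: distrib_left)
    also have "\<dots> \<le> e / 2" using \<eta>0(4) c by (simp add: field_simps)
    finally have 1: "norm ((F \<tau> ^^ i) z' - z') \<le> e / 2" by simp
    have "norm ((F \<tau> ^^ i) z - z) \<le> (K + 1) * norm (z - z') + norm ((F \<tau> ^^ i) z' - z')"
      using K(2) \<tau> i1 by (intro displacement_perturb) auto
    also have "\<dots> \<le> 2 * K * (e / (4 * K)) + e / 2"
      using z'(2) K(1) 1 by (intro add_mono mult_mono) (auto simp: norm_minus_commute)
    also have "\<dots> = e" using K(1) by (simp add: field_simps)
    finally show ?thesis .
  qed (use e in simp)
  then show ?thesis unfolding eventually_at_right_field using \<eta>0(1) by blast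
qed

text \<open>Finitely many balls of radius \<open>e / (4 * K)\<close> cover \<open>C\<close>.
  Smallness at the centres suffices, since moving to a centre costs at most \<open>K + 1\<close>
  times the radius, hence at most \<open>e / 2\<close>.\<close>

lemma equicontinuous_compact:
  assumes C: "compact C" and e: "e > 0"
  shows "\<forall>\<^sub>F \<eta> in at_right 0. \<forall>z\<in>C. \<forall>\<tau>>0. \<forall>i. real i * \<tau> \<le> \<eta> \<longrightarrow> norm ((F \<tau> ^^ i) z - z) \<le> e"
proof -
  obtain K where K: "K \<ge> 1"
    "\<And>\<tau> m x. 0 < \<tau> \<Longrightarrow> real m * \<tau> \<le> 1 \<Longrightarrow> norm ((F \<tau> ^^ m) x) \<le> K * norm x"
    using stableE[of 1] by blast
  have "e / (4 * K) > 0" using e K by simp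
  then obtain N where N: "finite N" "C \<subseteq> (\<Union>x\<in>N. ball x (e / (4 * K)))"
    using C unfolding compact_eq_totally_bounded by blast
  have "\<forall>\<^sub>F \<eta> in at_right 0. \<forall>z\<in>N. \<forall>\<tau>>0. \<forall>i. real i * \<tau> \<le> \<eta> \<longrightarrow> norm ((F \<tau> ^^ i) z - z) \<le> e / 2"
    using e by (intro eventually_ball_finite N ballI equicontinuous) auto
  moreover have "\<forall>\<^sub>F \<eta> in at_right (0::real). \<eta> < 1"
    by (rule eventually_at_rightI[of 0 1]) auto
  ultimately show ?thesis
  proof (eventually_elim, intro ballI allI impI)
    fix \<eta> z \<tau> i assume \<eta>: "\<forall>z\<in>N. \<forall>\<tau>>0. \<forall>i. real i * \<tau> \<le> \<eta> \<longrightarrow> norm ((F \<tau> ^^ i) z - z) \<le> e / 2" "\<eta> < 1"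
      and z: "z \<in> C" and \<tau>: "0 < \<tau>" "real i * \<tau> \<le> \<eta>"
    obtain z' where z': "z' \<in> N" "norm (z - z') \<le> e / (4 * K)"
      using N(2) z by (force simp: dist_norm norm_minus_commute)
    have "norm ((F \<tau> ^^ i) z - z) \<le> (K + 1) * norm (z - z') + norm ((F \<tau> ^^ i) z' - z')"
      using K(2) \<tau> \<eta>(2) by (intro displacement_perturb) auto
    also have "\<dots> \<le> 2 * K * (e / (4 * K)) + e / 2"
      using z' K(1) \<eta>(1) \<tau> by (intro add_mono mult_mono) auto
    also have "\<dots> = e" using K(1) by (simp add: field_simps)
    finally show "norm ((F \<tau> ^^ i) z - z) \<le> e" .
  qed
qed

text \<open>The pair \<open>(x, y)\<close> is replaced by a nearby point \<open>(x', Z x')\<close>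
  of the graph, where consistency applies, and stability controls the replacement. The nearby point
  is fixed before \<tau> tends to zero and serves all \<open>m\<close> at once.\<close>

lemma graph_increment:
  assumes xy: "(x, y) \<in> closure (operator_graph D Z)" and \<delta>: "\<delta> \<ge> 0" and e': "e' > 0"
    and e: "\<And>\<tau> i. 0 < \<tau> \<Longrightarrow> real i * \<tau> \<le> \<delta> \<Longrightarrow> norm ((F \<tau> ^^ i) y - y) \<le> e"
  shows "\<forall>\<^sub>F \<tau> in at_right 0. \<forall>m. real m * \<tau> \<le> \<delta> \<longrightarrow>
           norm ((F \<tau> ^^ m) x - x - (real m * \<tau>) *\<^sub>R y) \<le> e * \<delta> + e'"
proof -
  obtain K where K: "K \<ge> 1"
    "\<And>\<tau> m x. 0 < \<tau> \<Longrightarrow> real m * \<tau> \<le> \<delta> \<Longrightarrow> norm ((F \<tau> ^^ m) x) \<le> K * norm x"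
    using stableE[of \<delta>] by blast
  \<comment> \<open>Replacing \<open>(x, y)\<close> and the defect of consistency together cost
    \<kappa> times this denominator.\<close>
  define \<kappa> where "\<kappa> = e' / (K + 1 + 2 * K * \<delta>)"
  have "K + 1 + 2 * K * \<delta> > 0" using K(1) \<delta> by (simp add: add_pos_nonneg)
  then have \<kappa>: "\<kappa> > 0" "\<kappa> * (K + 1 + 2 * K * \<delta>) = e'"
    using e' by (auto simp: \<kappa>_def)
  obtain p where p: "p \<in> operator_graph D Z" "dist p (x, y) < \<kappa>"
    using xy \<kappa>(1) unfolding closure_approachable by blast
  obtain x' where x': "x' \<in> D" "p = (x', Z x')"
    using p(1) by (auto simp: operator_graph_def)
  have near: "norm (x - x') \<le> \<kappa>" "norm (Z x' - y) \<le> \<kappa>"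
    using p(2) dist_fst_le[of p "(x, y)"] dist_snd_le[of p "(x, y)"] x'(2)
    by (auto simp: dist_norm norm_minus_commute)
  have "e \<ge> 0" using e[of 1 0] \<delta> by simp
  show ?thesis
    using consistentE[OF x'(1) \<kappa>(1)] eventually_at_right_less[of 0]
  proof (eventually_elim, intro allI impI)
    fix \<tau> m assume c: "norm ((F \<tau> x' - x') /\<^sub>R \<tau> - Z x') < \<kappa>" and \<tau>: "0 < \<tau>" "real m * \<tau> \<le> \<delta>"
    have i: "real i * \<tau> \<le> \<delta>" if "i \<le> m" for i
      using of_nat_mult_le_trans[OF that \<tau>] .
    have "norm ((F \<tau> ^^ i) (Z x') - y) \<le> K * \<kappa> + e" if "i < m" for i
    proof -
      have "(F \<tau> ^^ i) (Z x') - y = (F \<tau> ^^ i) (Z x' - y) + ((F \<tau> ^^ i) y - y)"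
        using \<tau>(1) by (simp add: pow_diff)
      also have "norm \<dots> \<le> K * norm (Z x' - y) + e"
        using K(2) e \<tau>(1) i[of i] that by (intro norm_triangle_mono) auto
      also have "\<dots> \<le> K * \<kappa> + e" using near(2) K(1) by simp
      finally show ?thesis .
    qed
    then have "norm ((F \<tau> ^^ m) x' - x' - (real m * \<tau>) *\<^sub>R y)
        \<le> real m * \<tau> * (K * norm ((F \<tau> x' - x') /\<^sub>R \<tau> - Z x') + (K * \<kappa> + e))"
      using K(2) \<tau>(1) i by (intro increment_bound) auto
    also have "\<dots> \<le> \<delta> * (K * \<kappa> + (K * \<kappa> + e))"
      using \<tau> \<delta> c K(1) \<kappa>(1) \<open>e \<ge> 0\<close> by (intro mult_mono add_mono) auto
    finally have 1: "norm ((F \<tau> ^^ m) x' - x' - (real m * \<tau>) *\<^sub>R y) \<le> \<delta> * (2 * K * \<kappa> + e)"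
      by (simp add: algebra_simps)
    have "norm ((F \<tau> ^^ m) (x - x')) \<le> K * norm (x - x')" using K(2) \<tau> by blast
    also have "\<dots> \<le> K * \<kappa>" using near(1) K(1) by simp
    finally have 2: "norm ((F \<tau> ^^ m) (x - x')) \<le> K * \<kappa>" .
    have "(F \<tau> ^^ m) x - x - (real m * \<tau>) *\<^sub>R y =
        (F \<tau> ^^ m) (x - x') + (x' - x) + ((F \<tau> ^^ m) x' - x' - (real m * \<tau>) *\<^sub>R y)"
      using \<tau>(1) by (simp add: pow_diff)
    also have "norm \<dots> \<le> K * \<kappa> + \<kappa> + \<delta> * (2 * K * \<kappa> + e)"
      using 1 2 near(1) by (intro norm_triangle_mono) (auto simp: norm_minus_commute)
    also have "\<dots> = e * \<delta> + \<kappa> * (K + 1 + 2 * K * \<delta>)" by (simp add: algebra_simps)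
    finally show "norm ((F \<tau> ^^ m) x - x - (real m * \<tau>) *\<^sub>R y) \<le> e * \<delta> + e'"
      using \<kappa>(2) by simp
  qed
qed

text \<open>With \<open>m n\<close> steps of length \<open>\<tau> n\<close> the elapsed time only
  tends to \<delta>; the resulting defect in the linear term is absorbed in half of
  \<open>e'\<close>.\<close>

lemma graph_increment_limit:
  assumes xy: "(x, y) \<in> closure (operator_graph D Z)" and \<delta>: "\<delta> \<ge> 0" and e': "e' > 0"
    and e: "\<And>\<tau> i. 0 < \<tau> \<Longrightarrow> real i * \<tau> \<le> \<delta> \<Longrightarrow> norm ((F \<tau> ^^ i) y - y) \<le> e"
    and \<tau>: "filterlim \<tau> (at_right 0) G"
    and m: "\<forall>\<^sub>F n in G. real (m n) * \<tau> n \<le> \<delta>" "((\<lambda>n. real (m n) * \<tau> n) \<longlongrightarrow> \<delta>) G"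
  shows "\<forall>\<^sub>F n in G. norm ((F (\<tau> n) ^^ m n) x - x - \<delta> *\<^sub>R y) \<le> e * \<delta> + e'"
proof -
  have "\<forall>\<^sub>F \<tau> in at_right 0. \<forall>m. real m * \<tau> \<le> \<delta> \<longrightarrow>
           norm ((F \<tau> ^^ m) x - x - (real m * \<tau>) *\<^sub>R y) \<le> e * \<delta> + e' / 2"
    using e' by (intro graph_increment xy \<delta> e) auto
  from eventually_compose_filterlim[OF this \<tau>]
  have 1: "\<forall>\<^sub>F n in G. \<forall>m. real m * \<tau> n \<le> \<delta> \<longrightarrow>
           norm ((F (\<tau> n) ^^ m) x - x - (real m * \<tau> n) *\<^sub>R y) \<le> e * \<delta> + e' / 2" .
  have "((\<lambda>n. norm ((real (m n) * \<tau> n - \<delta>) *\<^sub>R y)) \<longlongrightarrow> norm ((\<delta> - \<delta>) *\<^sub>R y)) G"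
    by (intro tendsto_intros m)
  from order_tendstoD(2)[OF this, of "e' / 2"]
  have 2: "\<forall>\<^sub>F n in G. norm ((real (m n) * \<tau> n - \<delta>) *\<^sub>R y) < e' / 2"
    using e' by simp
  show ?thesis
    using 1 2 m(1)
  proof eventually_elim
    case (elim n)
    have "(F (\<tau> n) ^^ m n) x - x - \<delta> *\<^sub>R y = ((F (\<tau> n) ^^ m n) x - x - (real (m n) * \<tau> n) *\<^sub>R y)
        + (real (m n) * \<tau> n - \<delta>) *\<^sub>R y"
      by (simp add: algebra_simps)
    also have "norm \<dots> \<le> (e * \<delta> + e' / 2) + e' / 2"
      using elim by (intro norm_triangle_mono) auto
    finally show ?case by simp
  qed
qed

end

section \<open>Stable semigroups\<close>

lemma tendsto_slope:
  fixes u :: "real \<Rightarrow> 'x::real_normed_vector"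
  assumes "\<And>e. e > 0 \<Longrightarrow> \<forall>\<^sub>F h in at_right 0. norm (u h - x - h *\<^sub>R y) \<le> e * h"
  shows "((\<lambda>h. (u h - x) /\<^sub>R h) \<longlongrightarrow> y) (at_right 0)"
proof (rule tendstoI)
  fix e :: real assume "e > 0"
  then have "\<forall>\<^sub>F h in at_right 0. norm (u h - x - h *\<^sub>R y) \<le> e / 2 * h" by (intro assms) simp
  then show "\<forall>\<^sub>F h in at_right 0. dist ((u h - x) /\<^sub>R h) y < e"
    using eventually_at_right_less[of 0]
  proof eventually_elim
    case (elim h)
    have "(u h - x) /\<^sub>R h - y = (u h - x - h *\<^sub>R y) /\<^sub>R h"
      using elim(2) by (simp add: scaleR_diff_right)
    then have "norm ((u h - x) /\<^sub>R h - y) = norm (u h - x - h *\<^sub>R y) / h"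
      using elim(2) by (simp add: divide_inverse mult.commute)
    also have "\<dots> \<le> e / 2" using elim by (simp add: pos_divide_le_eq)
    finally have "norm ((u h - x) /\<^sub>R h - y) \<le> e / 2" .
    then show ?case using \<open>e > 0\<close> by (simp add: dist_norm)
  qed
qed

lemma eventually_at_right_obtain:
  fixes a :: real
  assumes "\<forall>\<^sub>F h in at_right a. P h"
  obtains h where "a < h" "P h"
  using eventually_happens'[OF _ eventually_conj[OF assms eventually_at_right_less]]
  by (metis trivial_limit_at_right_real)

lemma filterlim_divide_of_nat:
  fixes t :: real
  assumes "t > 0"
  shows "filterlim (\<lambda>n. t / real n) (at_right 0) sequentially"
proof -
  have "\<forall>\<^sub>F n in sequentially. t / real n \<in> {0<..} \<and> t / real n \<noteq> 0"
    using eventually_gt_at_top[of 0] by eventually_elim (use assms in simp)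
  then show ?thesis
    unfolding filterlim_at using lim_const_over_n by blast
qed

lemma semigroup_funpow:
  fixes T :: "real \<Rightarrow> 'x \<Rightarrow> 'x"
  assumes "T 0 = id" "\<And>r s. 0 \<le> r \<Longrightarrow> 0 \<le> s \<Longrightarrow> T (r + s) = T r \<circ> T s" "0 \<le> s"
  shows "T s ^^ m = T (real m * s)"
proof (induction m)
  case (Suc m)
  then show ?case using assms(2)[of s "real m * s"] assms(3) by (simp add: algebra_simps)
qed (simp add: assms(1))

text \<open>Being a stable family itself, \<open>T\<close> obeys every estimate above; strong
  continuity comes out of consistency on the dense set \<open>D\<close>. The semigroup law turns
  powers of \<open>T s\<close> into values of \<open>T\<close>.\<close>

locale stable_semigroup = stable_family T D Z
  for T :: "real \<Rightarrow> 'x::banach \<Rightarrow> 'x" and D Z +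
  assumes T_zero: "T 0 = id"
    and T_add: "\<And>r s. 0 \<le> r \<Longrightarrow> 0 \<le> s \<Longrightarrow> T (r + s) = T r \<circ> T s"
begin

lemma lin0: "0 \<le> s \<Longrightarrow> bounded_linear (T s)"
  using lin[of s] T_zero by (cases "s = 0") (auto simp: id_def bounded_linear_ident)

lemma pow_eq: "0 \<le> s \<Longrightarrow> T s ^^ m = T (real m * s)"
  by (rule semigroup_funpow[OF T_zero T_add])

lemma boundE:
  obtains K where "K \<ge> 1" "\<And>s x. 0 \<le> s \<Longrightarrow> s \<le> S \<Longrightarrow> norm (T s x) \<le> K * norm x"
proof -
  obtain K where K: "K \<ge> 1"
    "\<And>\<tau> m x. 0 < \<tau> \<Longrightarrow> real m * \<tau> \<le> S \<Longrightarrow> norm ((T \<tau> ^^ m) x) \<le> K * norm x"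
    using stableE[of S] by blast
  have "norm (T s x) \<le> K * norm x" if "0 \<le> s" "s \<le> S" for s x
    using K(2)[of s 1 x] that K(1) mult_right_mono[of 1 K "norm x"]
    by (cases "s = 0") (auto simp: T_zero)
  then show ?thesis using that K(1) by blast
qed

lemma near_zero:
  assumes "e > 0"
  shows "\<forall>\<^sub>F h in at_right 0. \<forall>s. 0 \<le> s \<and> s \<le> h \<longrightarrow> norm (T s x - x) \<le> e"
  using equicontinuous[OF assms, of x]
proof eventually_elim
  case (elim h)
  show ?case
  proof (intro allI impI)
    fix s assume s: "0 \<le> s \<and> s \<le> h"
    then show "norm (T s x - x) \<le> e"
      using elim[rule_format, of s 1] assms by (cases "s = 0") (auto simp: T_zero)
  qed
qed

text \<open>The semigroup law writes \<open>T b x - T a x\<close> as \<open>T a\<close> applied to a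
  displacement of \<open>x\<close> over the time \<open>b - a\<close>, so smallness near zero gives
  continuity from both sides.\<close>

lemma continuous_orbit: "continuous_on {0..S} (\<lambda>s. T s x)"
  unfolding continuous_on_iff
proof (intro ballI allI impI)
  fix r and e :: real assume r: "r \<in> {0..S}" and e: "0 < e"
  obtain K where K: "K \<ge> 1" "\<And>s x. 0 \<le> s \<Longrightarrow> s \<le> S \<Longrightarrow> norm (T s x) \<le> K * norm x"
    using boundE[of S] by blast
  have "e / (2 * K) > 0" using e K(1) by simp
  from near_zero[OF this, of x] obtain \<eta> where \<eta>: "0 < \<eta>"
    "\<And>s. 0 \<le> s \<Longrightarrow> s \<le> \<eta> \<Longrightarrow> norm (T s x - x) \<le> e / (2 * K)"
    by (rule eventually_at_right_obtain) blast
  have *: "norm (T b x - T a x) \<le> e / 2" if "0 \<le> a" "a \<le> b" "b \<le> S" "b - a < \<eta>" for a b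
  proof -
    interpret bounded_linear "T a" using that(1) by (rule lin0)
    have "T b x - T a x = T a (T (b - a) x - x)"
      using T_add[of a "b - a"] that by (simp add: diff)
    also have "norm \<dots> \<le> K * norm (T (b - a) x - x)" using that by (intro K) auto
    also have "\<dots> \<le> K * (e / (2 * K))" using \<eta>(2)[of "b - a"] that K(1) by (intro mult_left_mono) auto
    finally show ?thesis using K(1) by simp
  qed
  show "\<exists>d>0. \<forall>s\<in>{0..S}. dist s r < d \<longrightarrow> dist (T s x) (T r x) < e"
  proof (intro exI conjI ballI impI)
    fix s assume s: "s \<in> {0..S}" "dist s r < \<eta>"
    have "norm (T s x - T r x) \<le> e / 2"
      using *[of r s] *[of s r] s r by (cases "r \<le> s") (auto simp: dist_norm norm_minus_commute)
    then show "dist (T s x) (T r x) < e" using e by (simp add: dist_norm)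
  qed (rule \<eta>(1))
qed

text \<open>\<open>T h\<close> is the \<open>n\<close>-th power of \<open>T (h / n)\<close>, so the
  estimate for small steps applies with elapsed time exactly \<open>h\<close>, and its extra error
  \<open>e'\<close> is arbitrary.\<close>

lemma graph_increment_semigroup:
  assumes "(x, y) \<in> closure (operator_graph D Z)" "h \<ge> 0"
    and "\<And>s. 0 \<le> s \<Longrightarrow> s \<le> h \<Longrightarrow> norm (T s y - y) \<le> e"
  shows "norm (T h x - x - h *\<^sub>R y) \<le> e * h"
proof (cases "h = 0")
  case False
  then have h: "h > 0" using assms(2) by simp
  show ?thesis
  proof (rule field_le_epsilon)
    fix e' :: real assume "0 < e'"
    have "filterlim (\<lambda>n. h / real (Suc n)) (at_right 0) sequentially"
      using filterlim_compose[OF filterlim_divide_of_nat[OF h] filterlim_Suc] .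
    then have "\<forall>\<^sub>F n in sequentially.
        norm ((T (h / real (Suc n)) ^^ Suc n) x - x - h *\<^sub>R y) \<le> e * h + e'"
      using assms h \<open>0 < e'\<close> by (intro graph_increment_limit) (auto simp: pow_eq simp del: funpow.simps)
    moreover have "T (h / real (Suc n)) ^^ Suc n = T h" for n
      using h pow_eq[of "h / real (Suc n)" "Suc n"] by (simp del: funpow.simps of_nat_Suc)
    ultimately show "norm (T h x - x - h *\<^sub>R y) \<le> e * h + e'" by (simp del: funpow.simps)
  qed
qed (simp add: T_zero)

text \<open>Near time zero \<open>T s y\<close> stays close to \<open>y\<close>, so the increment
  estimate has an error \<open>o(h)\<close>. Thus the generator of \<open>T\<close> extends the
  closure of the graph of \<open>Z\<close>, which in particular is single-valued.\<close>

lemma closure_graph_generator: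
  assumes "(x, y) \<in> closure (operator_graph D Z)"
  shows "((\<lambda>h. (T h x - x) /\<^sub>R h) \<longlongrightarrow> y) (at_right 0)"
proof (rule tendsto_slope)
  fix e :: real assume "e > 0"
  show "\<forall>\<^sub>F h in at_right 0. norm (T h x - x - h *\<^sub>R y) \<le> e * h"
    using near_zero[OF \<open>e > 0\<close>, of y] eventually_at_right_less[of 0]
    by eventually_elim (intro graph_increment_semigroup assms, auto)
qed

lemma orbit_generator:
  assumes "((\<lambda>h. (T h x - x) /\<^sub>R h) \<longlongrightarrow> y) (at_right 0)" and s: "0 \<le> s"
  shows "((\<lambda>h. (T h (T s x) - T s x) /\<^sub>R h) \<longlongrightarrow> T s y) (at_right 0)"
proof -
  interpret bounded_linear "T s" using s by (rule lin0)
  have "((\<lambda>h. T s ((T h x - x) /\<^sub>R h)) \<longlongrightarrow> T s y) (at_right 0)"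
    by (rule tendsto[OF assms(1)])
  moreover have "\<forall>\<^sub>F h in at_right 0. T s ((T h x - x) /\<^sub>R h) = (T h (T s x) - T s x) /\<^sub>R h"
    using eventually_at_right_less[of 0]
  proof eventually_elim
    case (elim h)
    then have "T h \<circ> T s = T s \<circ> T h"
      using T_add[of s h] T_add[of h s] s by (metis add.commute less_imp_le)
    then have "T h (T s x) = T s (T h x)" by (metis comp_apply)
    then show ?case by (simp add: diff scaleR)
  qed
  ultimately show ?thesis by (rule Lim_transform_eventually)
qed

text \<open>Riemann sums of the orbits of points of \<open>A\<close> lie in \<open>\<Gamma>\<close>; they approximate the mean of
  an orbit over \<open>[0, h]\<close>, on which the generator acts as the difference quotient.\<close>
lemma generator_in_closed_subspace:
  assumes \<Gamma>: "closed \<Gamma>" "subspace \<Gamma>"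
    and A: "A \<subseteq> D" "closure A = UNIV"
    and inv: "\<And>f s. f \<in> A \<Longrightarrow> 0 \<le> s \<Longrightarrow> (T s f, T s (Z f)) \<in> \<Gamma>"
    and xy: "((\<lambda>h. (T h x - x) /\<^sub>R h) \<longlongrightarrow> y) (at_right 0)"
  shows "(x, y) \<in> \<Gamma>"
proof -
  obtain K where K: "K \<ge> 1" "\<And>s x. 0 \<le> s \<Longrightarrow> s \<le> 1 \<Longrightarrow> norm (T s x) \<le> K * norm x"
    using boundE[of 1] by blast
  have "\<exists>p\<in>\<Gamma>. dist p (x, y) < \<epsilon>" if "\<epsilon> > 0" for \<epsilon>
  proof -
    \<comment> \<open>Both components will be off by at most \<open>(2 * K + 2) * e\<close>, which
      puts the pair within \<epsilon> / 2.\<close>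
    define e where "e = \<epsilon> / (4 * (2 * K + 2))"
    have e: "e > 0" using that K(1) by (simp add: e_def)
    have "\<forall>\<^sub>F h in at_right (0::real). h < 1" by (rule eventually_at_rightI[of 0 1]) auto
    then have "\<forall>\<^sub>F h in at_right 0. (\<forall>s. 0 \<le> s \<and> s \<le> h \<longrightarrow> norm (T s x - x) \<le> e) \<and>
        dist ((T h x - x) /\<^sub>R h) y < e \<and> h < 1"
      by (intro eventually_conj near_zero e tendstoD[OF xy])
    then obtain h where h: "0 < h" "h < 1" "\<And>s. 0 \<le> s \<Longrightarrow> s \<le> h \<Longrightarrow> norm (T s x - x) \<le> e"
      "norm ((T h x - x) /\<^sub>R h - y) \<le> e"
      by (rule eventually_at_right_obtain) (auto simp: dist_norm)
    \<comment> \<open>Closeness of order \<open>e * h\<close> is demanded because the difference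
      quotient over \<open>[0, h]\<close> divides \<open>f - x\<close> by \<open>h\<close>.\<close>
    have "x \<in> closure A" "0 < e * h" using A e h by auto
    then obtain f where f: "f \<in> A" "norm (f - x) < e * h"
      unfolding closure_approachable dist_norm by blast
    have "e * h \<le> e" using e h by simp
    have "\<forall>\<^sub>F n in sequentially. norm ((T (h / real (Suc n)) f - f) /\<^sub>R (h / real (Suc n)) - Z f) < e"
    proof (rule eventually_compose_filterlim[OF consistentE[of f e]])
      show "filterlim (\<lambda>n. h / real (Suc n)) (at_right 0) sequentially"
        using filterlim_compose[OF filterlim_divide_of_nat[OF h(1)] filterlim_Suc] .
    qed (use e f A in auto)
    from eventually_happens'[OF sequentially_bot this]
    obtain n where n: "norm ((T (h / real (Suc n)) f - f) /\<^sub>R (h / real (Suc n)) - Z f) < e" ..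
    define N where "N = Suc n"
    define \<tau> where "\<tau> = h / real N"
    have N: "real N > 0" by (simp add: N_def)
    have \<tau>: "\<tau> > 0" "real N * \<tau> = h" using h N by (auto simp: \<tau>_def)
    define d where "d = (T \<tau> f - f) /\<^sub>R \<tau>"
    have d: "norm (d - Z f) < e" using n by (simp add: d_def \<tau>_def N_def)
    have j: "0 \<le> real j * \<tau>" "real j * \<tau> \<le> h" "real j * \<tau> \<le> 1" if "j < N" for j
      using of_nat_mult_le_trans[of j N \<tau> h] that \<tau> h by auto
    \<comment> \<open>Averaging preserves closeness to a fixed vector; this is used around
      \<open>x\<close> for the first component and around \<open>0\<close> for differences in the
      second.\<close>
    have mean: "norm ((\<Sum>j<N. v j) /\<^sub>R real N - c) \<le> b"
      if "\<And>j. j < N \<Longrightarrow> norm (v j - c) \<le> b" for v :: "nat \<Rightarrow> 'x" and c b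
    proof -
      have "(\<Sum>j<N. v j) /\<^sub>R real N - c = (\<Sum>j<N. v j - c) /\<^sub>R real N"
        using N by (simp add: sum_subtractf scaleR_diff_right sum_constant_scaleR)
      also have "norm \<dots> = norm (\<Sum>j<N. v j - c) / real N" by (simp add: divide_inverse mult.commute)
      also have "\<dots> \<le> (\<Sum>j<N. b) / real N"
        using that N by (intro divide_right_mono sum_norm_le) auto
      finally show ?thesis using N by simp
    qed
    define p1 where "p1 = (\<Sum>j<N. T (real j * \<tau>) f) /\<^sub>R real N"
    define p2 where "p2 = (\<Sum>j<N. T (real j * \<tau>) (Z f)) /\<^sub>R real N"
    have "(p1, p2) = (\<Sum>j<N. (T (real j * \<tau>) f, T (real j * \<tau>) (Z f))) /\<^sub>R real N"
      by (simp add: p1_def p2_def sum_prod)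
    also have "\<dots> \<in> \<Gamma>" using j f by (intro subspace_scale subspace_sum \<Gamma> inv) auto
    finally have "(p1, p2) \<in> \<Gamma>" .
    have "norm (T (real j * \<tau>) f - x) \<le> K * e + e" if "j < N" for j
    proof -
      interpret bounded_linear "T (real j * \<tau>)" using j that by (intro lin0)
      have "T (real j * \<tau>) f - x = T (real j * \<tau>) (f - x) + (T (real j * \<tau>) x - x)"
        by (simp add: diff)
      also have "norm \<dots> \<le> K * norm (f - x) + e"
        using K(2) h(3) j that by (intro norm_triangle_mono) auto
      also have "\<dots> \<le> K * e + e"
        using f(2) \<open>e * h \<le> e\<close> K(1) by simp
      finally show ?thesis .
    qed
    then have p1: "norm (p1 - x) \<le> K * e + e" unfolding p1_def by (rule mean)
    have "norm (T (real j * \<tau>) (Z f) - T (real j * \<tau>) d) \<le> K * e" if "j < N" for j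
    proof -
      interpret bounded_linear "T (real j * \<tau>)" using j that by (intro lin0)
      have "norm (T (real j * \<tau>) (Z f - d)) \<le> K * norm (Z f - d)" using K(2) j that by blast
      also have "\<dots> \<le> K * e" using d K(1) by (simp add: norm_minus_commute)
      finally show ?thesis by (simp add: diff)
    qed
    then have "norm ((\<Sum>j<N. T (real j * \<tau>) (Z f) - T (real j * \<tau>) d) /\<^sub>R real N - 0) \<le> K * e"
      by (intro mean) simp
    \<comment> \<open>This is why \<open>Z f\<close> is traded for the quotient \<open>d\<close>:
      the average of \<open>T (real j * \<tau>) d\<close> telescopes exactly to the difference
      quotient of \<open>f\<close> over \<open>[0, h]\<close>.\<close>
    moreover have "(\<Sum>j<N. T (real j * \<tau>) d) /\<^sub>R real N = (T h f - f) /\<^sub>R h"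
    proof -
      have "T (real j * \<tau>) d = (T (real (Suc j) * \<tau>) f - T (real j * \<tau>) f) /\<^sub>R \<tau>" if "j < N" for j
      proof -
        interpret bounded_linear "T (real j * \<tau>)" using j that by (intro lin0)
        have "T (real (Suc j) * \<tau>) = T (real j * \<tau>) \<circ> T \<tau>"
          using T_add[of "real j * \<tau>" \<tau>] \<tau> by (simp add: algebra_simps)
        then show ?thesis by (simp add: d_def scaleR diff)
      qed
      then have "(\<Sum>j<N. T (real j * \<tau>) d) = (\<Sum>j<N. T (real (Suc j) * \<tau>) f - T (real j * \<tau>) f) /\<^sub>R \<tau>"
        by (simp add: scaleR_sum_right)
      also have "\<dots> = (T h f - f) /\<^sub>R \<tau>"
        using sum_lessThan_telescope[of "\<lambda>j. T (real j * \<tau>) f" N] \<tau>(2) by (simp add: T_zero)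
      finally show ?thesis using \<tau>(2)[symmetric] by (simp add: mult.commute)
    qed
    ultimately have 1: "norm (p2 - (T h f - f) /\<^sub>R h) \<le> K * e"
      by (simp add: p2_def sum_subtractf scaleR_diff_right)
    have 2: "norm ((T h f - f) /\<^sub>R h - (T h x - x) /\<^sub>R h) \<le> K * e + e"
    proof -
      interpret bounded_linear "T h" using h by (intro lin0) simp
      have "(T h f - f) /\<^sub>R h - (T h x - x) /\<^sub>R h = (T h (f - x) - (f - x)) /\<^sub>R h"
        by (simp add: diff scaleR_diff_right)
      also have "norm \<dots> = norm (T h (f - x) - (f - x)) / h"
        using h by (simp add: divide_inverse mult.commute)
      also have "\<dots> \<le> (K * (e * h) + e * h) / h"
      proof (intro divide_right_mono order_trans[OF norm_triangle_ineq4 add_mono])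
        have "norm (T h (f - x)) \<le> K * norm (f - x)" using K(2) h by simp
        also have "\<dots> \<le> K * (e * h)" using f K(1) by (intro mult_left_mono) auto
        finally show "norm (T h (f - x)) \<le> K * (e * h)" .
      qed (use f h in auto)
      finally show ?thesis using h by (simp add: add_divide_distrib)
    qed
    have "p2 - y = (p2 - (T h f - f) /\<^sub>R h) + ((T h f - f) /\<^sub>R h - (T h x - x) /\<^sub>R h)
        + ((T h x - x) /\<^sub>R h - y)" by simp
    also have "norm \<dots> \<le> K * e + (K * e + e) + e"
      by (intro norm_triangle_mono 1 2 h(4))
    finally have p2: "norm (p2 - y) \<le> (2 * K + 2) * e" by (simp add: algebra_simps)
    have p1': "norm (p1 - x) \<le> (2 * K + 2) * e" 
    proof (rule order_trans)
      show "norm (p1 - x) \<le> (K + 1) * e" using p1 by (simp add: distrib_right)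
    qed (use K(1) e in simp)
    have "dist (p1, p2) (x, y) \<le> norm (p1 - x) + norm (p2 - y)"
      unfolding dist_Pair_Pair unfolding dist_norm by (rule sqrt_sum_squares_le_sum) auto
    also have "\<dots> \<le> 2 * ((2 * K + 2) * e)" using p1' p2 by simp
    also have "\<dots> = \<epsilon> / 2" using K(1) by (simp add: e_def field_simps)
    also have "\<dots> < \<epsilon>" using that by simp
    finally show ?thesis using \<open>(p1, p2) \<in> \<Gamma>\<close> by blast
  qed
  then have "(x, y) \<in> closure \<Gamma>" by (simp add: closure_approachable)
  then show ?thesis using \<Gamma>(1) by simp
qed

end

section \<open>Chernoff's product formula\<close>

context stable_family
begin

text \<open>Filter form of \<open>equicontinuous\<close>; it disposes of leftover steps whose total
  length vanishes.\<close>

lemma displacement_tendsto: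
  assumes \<tau>: "filterlim \<tau> (at_right 0) G" and i: "((\<lambda>n. real (i n) * \<tau> n) \<longlongrightarrow> 0) G"
  shows "((\<lambda>n. (F (\<tau> n) ^^ i n) z - z) \<longlongrightarrow> 0) G"
proof (rule tendstoI)
  fix e :: real assume "e > 0"
  then have "e / 2 > 0" by simp
  from equicontinuous[OF this, of z] obtain \<eta> where \<eta>: "0 < \<eta>"
    "\<And>\<tau> i. \<tau> > 0 \<Longrightarrow> real i * \<tau> \<le> \<eta> \<Longrightarrow> norm ((F \<tau> ^^ i) z - z) \<le> e / 2"
    by (rule eventually_at_right_obtain) blast
  have "\<forall>\<^sub>F n in G. \<tau> n > 0" using \<tau> by (simp add: filterlim_at eventually_conj_iff)
  then show "\<forall>\<^sub>F n in G. dist ((F (\<tau> n) ^^ i n) z - z) 0 < e"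
    using order_tendstoD(2)[OF i \<eta>(1)]
  proof eventually_elim
    case (elim n)
    then have "norm ((F (\<tau> n) ^^ i n) z - z) \<le> e / 2" by (intro \<eta>) auto
    then show ?case using \<open>e > 0\<close> by simp
  qed
qed

lemma pow_tendsto_zero:
  assumes \<tau>: "\<forall>\<^sub>F n in G. 0 < \<tau> n" and i: "\<forall>\<^sub>F n in G. real (i n) * \<tau> n \<le> S"
    and u: "(u \<longlongrightarrow> 0) G"
  shows "((\<lambda>n. (F (\<tau> n) ^^ i n) (u n)) \<longlongrightarrow> 0) G"
proof -
  obtain K where K: "K \<ge> 1"
    "\<And>\<tau> m x. 0 < \<tau> \<Longrightarrow> real m * \<tau> \<le> S \<Longrightarrow> norm ((F \<tau> ^^ m) x) \<le> K * norm x"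
    using stableE[of S] by blast
  show ?thesis
  proof (rule tendsto_0_le[OF u])
    show "\<forall>\<^sub>F n in G. norm ((F (\<tau> n) ^^ i n) (u n)) \<le> norm (u n) * K"
      using \<tau> i by eventually_elim (simp add: K(2) mult.commute)
  qed
qed

text \<open>The vectors \<open>v j\<close>, where the first \<open>j\<close> blocks follow
  \<open>u\<close> and the others follow \<open>F \<tau>\<close>, run from
  \<open>(F \<tau> ^^ (J * k)) (u 0)\<close> to \<open>u J\<close>; neighbours differ by one block
  error, amplified by at most \<open>K\<close>.\<close>

lemma telescope_bound:
  fixes u :: "nat \<Rightarrow> 'x"
  assumes \<tau>: "0 < \<tau>"
    and K: "\<And>m y. m \<le> J * k \<Longrightarrow> norm ((F \<tau> ^^ m) y) \<le> K * norm y" "K \<ge> 0"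
    and b: "\<And>j. j < J \<Longrightarrow> norm ((F \<tau> ^^ k) (u j) - u (Suc j)) \<le> b"
  shows "norm ((F \<tau> ^^ (J * k)) (u 0) - u J) \<le> real J * (K * b)"
proof -
  define v where "v j = (F \<tau> ^^ ((J - j) * k)) (u j)" for j
  have "norm (v (Suc j) - v j) \<le> K * b" if "j < J" for j
  proof -
    have "J - j = Suc (J - Suc j)" using that by (simp add: Suc_diff_Suc)
    then have "(J - j) * k = (J - Suc j) * k + k" by simp
    then have "v j = (F \<tau> ^^ ((J - Suc j) * k)) ((F \<tau> ^^ k) (u j))"
      by (simp add: v_def funpow_add)
    then have "v j - v (Suc j) = (F \<tau> ^^ ((J - Suc j) * k)) ((F \<tau> ^^ k) (u j) - u (Suc j))"
      using \<tau> by (simp add: v_def pow_diff)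
    also have "norm \<dots> \<le> K * norm ((F \<tau> ^^ k) (u j) - u (Suc j))" by (intro K) simp
    also have "\<dots> \<le> K * b" using b[OF that] K(2) by (rule mult_left_mono)
    finally show ?thesis by (simp add: norm_minus_commute)
  qed
  then have "norm (\<Sum>j<J. v (Suc j) - v j) \<le> (\<Sum>j<J. K * b)" by (intro sum_norm_le) simp
  moreover have "(\<Sum>j<J. v (Suc j) - v j) = v J - v 0" by (rule sum_lessThan_telescope)
  ultimately show ?thesis by (simp add: v_def norm_minus_commute)
qed

end

context stable_semigroup
begin

text \<open>The time interval is cut into \<open>J\<close> pieces of length \<open>\<delta>\<close>;
  on each of them both \<open>F \<tau> ^^ k\<close> and \<open>T \<delta>\<close> agree with \<open>x \<mapsto> x + \<delta> Z x\<close> up to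
  \<open>o(\<delta>)\<close>, uniformly along the compact orbit of \<open>Z f\<close>.\<close>
theorem chernoff_product_formula:
  fixes G :: "'n filter"
  assumes F: "stable_family F D Z"
    and inv: "\<And>s. 0 \<le> s \<Longrightarrow> (T s f, T s (Z f)) \<in> closure (operator_graph D Z)"
    and \<tau>: "filterlim \<tau> (at_right 0) G"
    and N: "\<forall>\<^sub>F n in G. real (N n) * \<tau> n \<le> S" "((\<lambda>n. real (N n) * \<tau> n) \<longlongrightarrow> S) G"
    and S: "S \<ge> 0"
  shows "((\<lambda>n. (F (\<tau> n) ^^ N n) f) \<longlongrightarrow> T S f) G"
proof (rule tendstoI)
  interpret F: stable_family F D Z by (rule F)
  fix \<epsilon> :: real assume \<epsilon>: "\<epsilon> > 0"
  obtain K where K: "K \<ge> 1"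
    "\<And>\<tau> m x. 0 < \<tau> \<Longrightarrow> real m * \<tau> \<le> S \<Longrightarrow> norm ((F \<tau> ^^ m) x) \<le> K * norm x"
    using F.stableE[of S] by blast
  \<comment> \<open>Adding \<open>1\<close> keeps the divisor in \<open>e\<close> positive when
    \<open>S = 0\<close>.\<close>
  define c where "c = S + 1"
  have c: "c > 0" "S \<le> c" using S by (simp_all add: c_def)
  define e where "e = \<epsilon> / (8 * K * c)"
  have e: "e > 0" using \<epsilon> K(1) c(1) by (simp add: e_def)
  have \<tau>_pos: "\<forall>\<^sub>F n in G. \<tau> n > 0" and \<tau>0: "(\<tau> \<longlongrightarrow> 0) G"
    using \<tau> by (simp_all add: filterlim_at eventually_conj_iff)
  \<comment> \<open>Compactness of the orbit of \<open>Z f\<close> makes a single \<eta> serve all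
    intermediate points, whatever their number.\<close>
  define C where "C = (\<lambda>s. T s (Z f)) ` {0..S}"
  have "compact C" unfolding C_def by (intro compact_continuous_image continuous_orbit) simp
  then have "\<forall>\<^sub>F \<eta> in at_right 0.
      (\<forall>z\<in>C. \<forall>\<tau>>0. \<forall>i. real i * \<tau> \<le> \<eta> \<longrightarrow> norm ((F \<tau> ^^ i) z - z) \<le> e) \<and>
      (\<forall>z\<in>C. \<forall>\<tau>>0. \<forall>i. real i * \<tau> \<le> \<eta> \<longrightarrow> norm ((T \<tau> ^^ i) z - z) \<le> e)"
    by (intro eventually_conj F.equicontinuous_compact equicontinuous_compact e)
  then obtain \<eta> where \<eta>: "\<eta> > 0"
    "\<And>z \<tau> i. z \<in> C \<Longrightarrow> \<tau> > 0 \<Longrightarrow> real i * \<tau> \<le> \<eta> \<Longrightarrow> norm ((F \<tau> ^^ i) z - z) \<le> e"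
    "\<And>z \<tau> i. z \<in> C \<Longrightarrow> \<tau> > 0 \<Longrightarrow> real i * \<tau> \<le> \<eta> \<Longrightarrow> norm ((T \<tau> ^^ i) z - z) \<le> e"
    by (rule eventually_at_right_obtain) blast
  \<comment> \<open>\<open>J\<close> is fixed before the limit along \<open>G\<close> is taken; it
    makes the length \<delta> of a piece at most \<eta>.\<close>
  obtain J :: nat where J: "real J > S / \<eta>" using reals_Archimedean2 by blast
  then have J0: "real J > 0" using S \<eta>(1) by (meson divide_nonneg_pos le_less_trans)
  define \<delta> where "\<delta> = S / real J"
  have \<delta>: "0 \<le> \<delta>" "\<delta> \<le> \<eta>" "real J * \<delta> = S"
    using J J0 S \<eta>(1) by (auto simp: \<delta>_def field_simps)
  define u where "u j = T (real j * \<delta>) f" for j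
  \<comment> \<open>Each of the \<open>J\<close> pieces receives \<open>k n\<close> steps; the
    remaining \<open>r n < J\<close> steps take a time that vanishes with
    \<open>\<tau> n\<close>.\<close>
  define k where "k n = N n div J" for n
  define r where "r n = N n mod J" for n
  have Nk: "N n = J * k n + r n" for n by (simp add: k_def r_def)
  have kle: "real (k n) * \<tau> n \<le> \<delta>" "real (J * k n) * \<tau> n \<le> S"
    if "0 < \<tau> n" "real (N n) * \<tau> n \<le> S" for n
  proof -
    show *: "real (J * k n) * \<tau> n \<le> S"
      using of_nat_mult_le_trans[OF _ that, of "J * k n"] Nk by simp
    then show "real (k n) * \<tau> n \<le> \<delta>" using J0 by (simp add: \<delta>_def field_simps)
  qed
  have r0: "((\<lambda>n. real (r n) * \<tau> n) \<longlongrightarrow> 0) G"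
  proof (rule tendsto_0_le[OF \<tau>0])
    show "\<forall>\<^sub>F n in G. norm (real (r n) * \<tau> n) \<le> norm (\<tau> n) * real J"
    proof (intro always_eventually allI)
      fix n
      have "real (r n) \<le> real J" using J0 by (simp add: r_def less_imp_le)
      then have "norm (\<tau> n) * real (r n) \<le> norm (\<tau> n) * real J"
        by (intro mult_left_mono) auto
      then show "norm (real (r n) * \<tau> n) \<le> norm (\<tau> n) * real J"
        by (simp only: norm_mult norm_of_nat mult.commute)
    qed
  qed
  have "((\<lambda>n. (real (N n) * \<tau> n - real (r n) * \<tau> n) / real J) \<longlongrightarrow> (S - 0) / real J) G"
    using J0 by (intro tendsto_intros N r0) auto
  moreover have "(real (N n) * \<tau> n - real (r n) * \<tau> n) / real J = real (k n) * \<tau> n" for n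
    using J0 by (simp add: Nk algebra_simps)
  ultimately have k: "((\<lambda>n. real (k n) * \<tau> n) \<longlongrightarrow> \<delta>) G" by (simp add: \<delta>_def)
  have k_le: "\<forall>\<^sub>F n in G. real (k n) * \<tau> n \<le> \<delta>"
    using \<tau>_pos N(1) by eventually_elim (rule kle)
  define e' where "e' = \<epsilon> / (4 * K * real J)"
  have e': "e' > 0" using \<epsilon> K(1) J0 by (simp add: e'_def)
  have step: "\<forall>\<^sub>F n in G. norm ((F (\<tau> n) ^^ k n) (u j) - u (Suc j)) \<le> 2 * (e * \<delta>) + e'"
    if "j < J" for j
  proof -
    define y where "y = T (real j * \<delta>) (Z f)"
    have "real j * \<delta> \<le> S" using that \<delta> mult_right_mono[of "real j" "real J" \<delta>] by simp
    then have y: "(u j, y) \<in> closure (operator_graph D Z)" "y \<in> C"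
      using inv \<delta>(1) by (auto simp: u_def y_def C_def)
    have T_near: "norm (T s y - y) \<le> e" if "0 \<le> s" "s \<le> \<delta>" for s
      using \<eta>(3)[OF y(2), of s 1] that \<delta>(2) e by (cases "s = 0") (auto simp: T_zero)
    have "norm (T \<delta> (u j) - u j - \<delta> *\<^sub>R y) \<le> e * \<delta>"
      using y(1) \<delta>(1) T_near by (rule graph_increment_semigroup)
    moreover have "T \<delta> (u j) = u (Suc j)"
      using T_add[of \<delta> "real j * \<delta>"] \<delta>(1) by (simp add: u_def algebra_simps)
    ultimately have 1: "norm (u (Suc j) - u j - \<delta> *\<^sub>R y) \<le> e * \<delta>" by simp
    have "\<forall>\<^sub>F n in G. norm ((F (\<tau> n) ^^ k n) (u j) - u j - \<delta> *\<^sub>R y) \<le> e * \<delta> + e'"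
      using \<eta>(2)[OF y(2)] \<delta>(2)
      by (intro F.graph_increment_limit[OF y(1) \<delta>(1) e' _ \<tau> k_le k]) auto
    then show ?thesis
    proof eventually_elim
      case (elim n)
      have "(F (\<tau> n) ^^ k n) (u j) - u (Suc j) =
          ((F (\<tau> n) ^^ k n) (u j) - u j - \<delta> *\<^sub>R y) - (u (Suc j) - u j - \<delta> *\<^sub>R y)" by simp
      also have "norm \<dots> \<le> (e * \<delta> + e') + e * \<delta>"
        by (rule order_trans[OF norm_triangle_ineq4 add_mono[OF elim 1]])
      finally show ?case by linarith
    qed
  qed
  have "\<forall>\<^sub>F n in G. \<forall>j\<in>{..<J}. norm ((F (\<tau> n) ^^ k n) (u j) - u (Suc j)) \<le> 2 * (e * \<delta>) + e'"
    using step by (intro eventually_ball_finite) auto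
  moreover have "\<forall>\<^sub>F n in G. dist ((F (\<tau> n) ^^ r n) f - f) 0 < \<epsilon> / (4 * K)"
    using \<epsilon> K(1) by (intro tendstoD F.displacement_tendsto \<tau> r0) auto
  ultimately show "\<forall>\<^sub>F n in G. dist ((F (\<tau> n) ^^ N n) f) (T S f) < \<epsilon>"
    using \<tau>_pos N(1)
  proof eventually_elim
    case (elim n)
    note Jk = kle(2)[OF elim(3,4)]
    \<comment> \<open>The contributions of \<open>e\<close> and of \<open>e'\<close> are at most
      \<epsilon> / 4 each; the leftover steps add another \<epsilon> / 4 below.\<close>
    have "norm ((F (\<tau> n) ^^ (J * k n)) (u 0) - u J) \<le> real J * (K * (2 * (e * \<delta>) + e'))"
    proof (rule F.telescope_bound[OF elim(3)])
      show "norm ((F (\<tau> n) ^^ m) y) \<le> K * norm y" if "m \<le> J * k n" for m y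
        using K(2) elim(3) of_nat_mult_le_trans[OF that elim(3) Jk] by blast
    qed (use elim K in auto)
    also have "\<dots> = 2 * (K * e) * (real J * \<delta>) + real J * K * e'" by (simp add: algebra_simps)
    also have "K * e = \<epsilon> / (8 * c)" using K(1) by (simp add: e_def)
    also have "real J * K * e' = \<epsilon> / 4" using K(1) J0 by (simp add: e'_def)
    also have "2 * (\<epsilon> / (8 * c)) * (real J * \<delta>) = \<epsilon> / 4 * (S / c)"
      unfolding \<delta>(3) using c(1) by (simp add: field_simps)
    also have "\<epsilon> / 4 * (S / c) + \<epsilon> / 4 \<le> \<epsilon> / 4 * 1 + \<epsilon> / 4"
      using \<epsilon> c by (intro add_mono mult_left_mono) auto
    finally have 1: "norm ((F (\<tau> n) ^^ (J * k n)) f - T S f) \<le> \<epsilon> / 2"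
      using \<delta>(3) by (simp add: u_def T_zero)
    have "norm ((F (\<tau> n) ^^ (J * k n)) ((F (\<tau> n) ^^ r n) f - f)) \<le> K * norm ((F (\<tau> n) ^^ r n) f - f)"
      using K(2)[OF elim(3) Jk] .
    also have "\<dots> \<le> K * (\<epsilon> / (4 * K))" using elim(2) K(1) by (intro mult_left_mono) auto
    also have "\<dots> = \<epsilon> / 4" using K(1) by simp
    finally have 2: "norm ((F (\<tau> n) ^^ (J * k n)) ((F (\<tau> n) ^^ r n) f - f)) \<le> \<epsilon> / 4" .
    have "(F (\<tau> n) ^^ N n) f - T S f = (F (\<tau> n) ^^ (J * k n)) ((F (\<tau> n) ^^ r n) f - f)
        + ((F (\<tau> n) ^^ (J * k n)) f - T S f)"
      using elim(3) by (simp add: Nk funpow_add F.pow_diff)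
    also have "norm \<dots> \<le> \<epsilon> / 4 + \<epsilon> / 2" by (intro norm_triangle_mono 1 2)
    also have "\<dots> < \<epsilon>" using \<epsilon> by simp
    finally show ?case by (simp add: dist_norm)
  qed
qed

end

section \<open>Limits along a filter\<close>

text \<open>The uniform Lipschitz bound transports the Cauchy property from points
  \<open>f k\<close> of \<open>A\<close> tending to \<open>x\<close> to the limits
  \<open>l k\<close>, and the limit of these is the limit at \<open>x\<close>.\<close>

lemma convergent_from_dense:
  fixes B :: "'n \<Rightarrow> 'x::real_normed_vector \<Rightarrow> 'y::banach"
  assumes H: "H \<noteq> bot"
    and K: "K > 0" "\<forall>\<^sub>F n in H. \<forall>x y. norm (B n x - B n y) \<le> K * norm (x - y)"
    and A: "closure A = UNIV" "\<And>f. f \<in> A \<Longrightarrow> \<exists>l. ((\<lambda>n. B n f) \<longlongrightarrow> l) H"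
  shows "\<exists>l. ((\<lambda>n. B n x) \<longlongrightarrow> l) H"
proof -
  have "x \<in> closure A" using A(1) by simp
  then obtain f where f: "\<And>k. f k \<in> A" "f \<longlonglongrightarrow> x" unfolding closure_sequential by blast
  have "\<exists>l. \<forall>k. ((\<lambda>n. B n (f k)) \<longlongrightarrow> l k) H"
    using A(2) f(1) by (intro choice allI) blast
  then obtain l where l: "\<And>k. ((\<lambda>n. B n (f k)) \<longlongrightarrow> l k) H" by blast
  have ll: "norm (l j - l k) \<le> K * norm (f j - f k)" for j k
  proof (rule tendsto_upperbound[OF _ _ H])
    show "((\<lambda>n. norm (B n (f j) - B n (f k))) \<longlongrightarrow> norm (l j - l k)) H"
      by (intro tendsto_intros l)
    show "\<forall>\<^sub>F n in H. norm (B n (f j) - B n (f k)) \<le> K * norm (f j - f k)"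
      using K(2) by eventually_elim blast
  qed
  have "Cauchy l"
  proof (rule CauchyI)
    fix e :: real assume "e > 0"
    then have "e / K > 0" using K(1) by simp
    moreover have "Cauchy f" using f(2) by (rule LIMSEQ_imp_Cauchy)
    ultimately obtain M where M: "\<And>m n. m \<ge> M \<Longrightarrow> n \<ge> M \<Longrightarrow> norm (f m - f n) < e / K"
      using CauchyD by blast
    have "norm (l m - l n) < e" if "m \<ge> M" "n \<ge> M" for m n
      using ll[of m n] M[OF that] K(1) by (simp add: field_simps)
    then show "\<exists>M. \<forall>m\<ge>M. \<forall>n\<ge>M. norm (l m - l n) < e" by blast
  qed
  then obtain L where L: "l \<longlonglongrightarrow> L" by (auto simp: Cauchy_convergent_iff convergent_def)
  have "((\<lambda>n. B n x) \<longlongrightarrow> L) H"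
  proof (rule tendstoI)
    fix e :: real assume e: "e > 0"
    then have "e / (3 * K) > 0" "e / 3 > 0" using K(1) by simp_all
    then have "\<forall>\<^sub>F k in sequentially. dist (f k) x < e / (3 * K) \<and> dist (l k) L < e / 3"
      using f(2) L by (intro eventually_conj tendstoD)
    from eventually_happens'[OF sequentially_bot this] obtain k where
      k: "dist (f k) x < e / (3 * K)" "dist (l k) L < e / 3" by blast
    show "\<forall>\<^sub>F n in H. dist (B n x) L < e"
      using K(2) tendstoD[OF l \<open>e / 3 > 0\<close>, of k]
    proof eventually_elim
      case (elim n)
      have "dist (B n x) (B n (f k)) \<le> K * dist (f k) x"
        using elim(1) by (simp add: dist_norm norm_minus_commute)
      also have "\<dots> \<le> K * (e / (3 * K))" using k(1) K(1) by (intro mult_left_mono) auto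
      also have "\<dots> = e / 3" using K(1) by simp
      finally have "dist (B n x) (B n (f k)) \<le> e / 3" .
      then show ?case
        using elim(2) k(2) dist_triangle[of "B n x" L "B n (f k)"] dist_triangle[of "B n (f k)" L "l k"]
        by linarith
    qed
  qed
  then show ?thesis ..
qed

text \<open>The exponent in (a) at parameter \<open>s / t\<close> corresponds to the time
  \<open>s\<close>, with a deficit of at most one step.\<close>

lemma floor_multiple_bounds:
  fixes t s :: real
  assumes "t > 0" "s \<ge> 0" "n > 0"
  shows "real (nat \<lfloor>real n * (s / t)\<rfloor>) * (t / real n) \<le> s"
    and "s - t / real n \<le> real (nat \<lfloor>real n * (s / t)\<rfloor>) * (t / real n)"
proof -
  have nn: "real n * (s / t) \<ge> 0" using assms by simp
  have s: "real n * (s / t) * (t / real n) = s" using assms by simp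
  have "real (nat \<lfloor>real n * (s / t)\<rfloor>) * (t / real n) \<le> real n * (s / t) * (t / real n)"
    using assms by (intro mult_right_mono of_nat_floor nn) auto
  then show "real (nat \<lfloor>real n * (s / t)\<rfloor>) * (t / real n) \<le> s" using s by simp
  have "(real n * (s / t) - 1) * (t / real n) \<le> real (nat \<lfloor>real n * (s / t)\<rfloor>) * (t / real n)"
  proof (rule mult_right_mono)
    show "real n * (s / t) - 1 \<le> real (nat \<lfloor>real n * (s / t)\<rfloor>)" by linarith
  qed (use assms in simp)
  moreover have "(real n * (s / t) - 1) * (t / real n) = s - t / real n"
    unfolding left_diff_distrib s by simp
  ultimately show "s - t / real n \<le> real (nat \<lfloor>real n * (s / t)\<rfloor>) * (t / real n)" by simp
qed

lemma floor_multiple_tendsto: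
  fixes t s :: real
  assumes "t > 0" "s \<ge> 0"
  shows "\<forall>\<^sub>F n in sequentially. real (nat \<lfloor>real n * (s / t)\<rfloor>) * (t / real n) \<le> s"
    and "(\<lambda>n. real (nat \<lfloor>real n * (s / t)\<rfloor>) * (t / real n)) \<longlonglongrightarrow> s"
proof -
  show 1: "\<forall>\<^sub>F n in sequentially. real (nat \<lfloor>real n * (s / t)\<rfloor>) * (t / real n) \<le> s"
    using eventually_gt_at_top[of 0]
    by eventually_elim (rule floor_multiple_bounds(1)[OF assms])
  have 2: "\<forall>\<^sub>F n in sequentially. s - t / real n \<le> real (nat \<lfloor>real n * (s / t)\<rfloor>) * (t / real n)"
    using eventually_gt_at_top[of 0]
    by eventually_elim (rule floor_multiple_bounds(2)[OF assms])
  have "(\<lambda>n. s - t / real n) \<longlonglongrightarrow> s - 0" by (intro tendsto_intros lim_const_over_n)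
  then show "(\<lambda>n. real (nat \<lfloor>real n * (s / t)\<rfloor>) * (t / real n)) \<longlonglongrightarrow> s"
    using tendsto_sandwich[OF 2 1] by simp
qed

context stable_family
begin

text \<open>Stability extends convergence from \<open>A\<close> to all vectors, and bounds and
  linearity pass to the limit. The semigroup law holds because the step counts for
  \<open>r + s\<close> and for \<open>r\<close> and \<open>s\<close> together differ by at most one;
  consistency is the increment estimate in the limit.\<close>

lemma limit_semigroup:
  fixes t :: real and H :: "nat filter"
  assumes t: "t > 0" and H: "H \<le> sequentially" "H \<noteq> bot"
    and A: "closure A = UNIV"
      "\<And>f s. f \<in> A \<Longrightarrow> 0 \<le> s \<Longrightarrow> \<exists>l. ((\<lambda>n. (F (t / real n) ^^ nat \<lfloor>real n * (s / t)\<rfloor>) f) \<longlongrightarrow> l) H"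
  shows "\<exists>T. stable_semigroup T D Z \<and>
    (\<forall>s\<ge>0. \<forall>x. ((\<lambda>n. (F (t / real n) ^^ nat \<lfloor>real n * (s / t)\<rfloor>) x) \<longlongrightarrow> T s x) H)"
proof -
  define \<tau> where "\<tau> n = t / real n" for n :: nat
  define N where "N s n = nat \<lfloor>real n * (s / t)\<rfloor>" for s :: real and n :: nat
  have seqH: "\<And>P. eventually P sequentially \<Longrightarrow> eventually P H" using H(1) by (rule filter_leD)
  have \<tau>: "filterlim \<tau> (at_right 0) H"
    using filterlim_mono[OF filterlim_divide_of_nat[OF t] order_refl H(1)] by (simp add: \<tau>_def[abs_def])
  then have \<tau>0: "(\<tau> \<longlongrightarrow> 0) H" by (simp add: filterlim_at)
  have pos: "\<forall>\<^sub>F n in H. 0 < \<tau> n"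
    using \<tau> by (simp add: filterlim_at eventually_conj_iff)
  have N: "\<forall>\<^sub>F n in H. real (N s n) * \<tau> n \<le> s" "((\<lambda>n. real (N s n) * \<tau> n) \<longlongrightarrow> s) H"
    if "0 \<le> s" for s
    using seqH[OF floor_multiple_tendsto(1)[OF t that]]
      filterlim_mono[OF floor_multiple_tendsto(2)[OF t that] order_refl H(1)]
    by (simp_all add: \<tau>_def N_def)
  define U where "U s n = F (\<tau> n) ^^ N s n" for s n
  \<comment> \<open>The value of \<open>Lim\<close> is meaningful once \<open>lim\<close> below has
    shown convergence, for nonnegative \<open>s\<close>.\<close>
  define T where "T s x = Lim H (\<lambda>n. U s n x)" for s x
  have bound: "\<exists>K\<ge>1. \<forall>s\<in>{0..S}. \<forall>\<^sub>F n in H. \<forall>x. norm (U s n x) \<le> K * norm x" for S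
  proof -
    obtain K where K: "K \<ge> 1"
      "\<And>\<tau> m x. 0 < \<tau> \<Longrightarrow> real m * \<tau> \<le> S \<Longrightarrow> norm ((F \<tau> ^^ m) x) \<le> K * norm x"
      using stableE[of S] by blast
    have "\<forall>\<^sub>F n in H. \<forall>x. norm (U s n x) \<le> K * norm x" if s: "s \<in> {0..S}" for s
    proof -
      have "0 \<le> s" using s by simp
      show ?thesis
        using pos N(1)[OF \<open>0 \<le> s\<close>] by eventually_elim (use K(2) s in \<open>auto simp: U_def\<close>)
    qed
    then show ?thesis using K(1) by blast
  qed
  have Ulin: "\<forall>\<^sub>F n in H. bounded_linear (U s n)" for s
    using pos by eventually_elim (simp add: U_def lin_pow)
  have lim: "((\<lambda>n. U s n x) \<longlongrightarrow> T s x) H" if s: "0 \<le> s" for s x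
  proof -
    obtain K where K: "K \<ge> 1" "\<forall>\<^sub>F n in H. \<forall>x. norm (U s n x) \<le> K * norm x"
      using bound[of s] s by auto
    have "\<exists>l. ((\<lambda>n. U s n x) \<longlongrightarrow> l) H"
    proof (rule convergent_from_dense[OF H(2) _ _ A(1)])
      show "\<forall>\<^sub>F n in H. \<forall>x y. norm (U s n x - U s n y) \<le> K * norm (x - y)"
        using K(2) Ulin[of s]
      proof eventually_elim
        case (elim n)
        then show ?case using linear_diff[OF bounded_linear.linear] by metis
      qed
      show "\<exists>l. ((\<lambda>n. U s n f) \<longlongrightarrow> l) H" if "f \<in> A" for f
        using A(2)[OF that s] by (simp add: U_def N_def \<tau>_def)
    qed (use K(1) in simp)
    then show ?thesis unfolding T_def using tendsto_Lim[OF H(2)] by metis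
  qed
  have T_bound: "\<exists>K\<ge>1. \<forall>s\<in>{0..S}. \<forall>x. norm (T s x) \<le> K * norm x" for S
  proof -
    obtain K where K: "K \<ge> 1" "\<And>s. s \<in> {0..S} \<Longrightarrow> \<forall>\<^sub>F n in H. \<forall>x. norm (U s n x) \<le> K * norm x"
      using bound[of S] by blast
    have "norm (T s x) \<le> K * norm x" if "s \<in> {0..S}" for s x
    proof (rule tendsto_upperbound[OF _ _ H(2)])
      show "((\<lambda>n. norm (U s n x)) \<longlongrightarrow> norm (T s x)) H"
        using that by (intro tendsto_intros lim) auto
      show "\<forall>\<^sub>F n in H. norm (U s n x) \<le> K * norm x"
        using K(2)[OF that] by eventually_elim blast
    qed
    then show ?thesis using K(1) by blast
  qed
  have T_lin: "bounded_linear (T s)" if s: "0 \<le> s" for s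
  proof -
    obtain K where K: "\<And>x. norm (T s x) \<le> K * norm x" using T_bound[of s] s by (meson atLeastAtMost_iff order_refl)
    show ?thesis
    proof (rule bounded_linear_intro)
      fix x y :: 'x and c :: real
      have "\<forall>\<^sub>F n in H. U s n x + U s n y = U s n (x + y)"
        using Ulin[of s] by eventually_elim (simp add: linear_add bounded_linear.linear)
      from Lim_transform_eventually[OF tendsto_add[OF lim[OF s] lim[OF s]] this]
      show "T s (x + y) = T s x + T s y"
        using tendsto_unique[OF H(2) lim[OF s]] by blast
      have "\<forall>\<^sub>F n in H. c *\<^sub>R U s n x = U s n (c *\<^sub>R x)"
        using Ulin[of s] by eventually_elim (simp add: linear_scale bounded_linear.linear)
      from Lim_transform_eventually[OF tendsto_scaleR[OF tendsto_const lim[OF s]] this]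
      show "T s (c *\<^sub>R x) = c *\<^sub>R T s x"
        using tendsto_unique[OF H(2) lim[OF s]] by blast
      show "norm (T s x) \<le> norm x * K" using K by (simp add: mult.commute)
    qed
  qed
  have T_zero: "T 0 = id"
  proof
    fix x
    have "((\<lambda>n. x) \<longlongrightarrow> T 0 x) H" using lim[of 0 x] by (simp add: U_def N_def)
    then show "T 0 x = id x" using tendsto_unique[OF H(2) _ tendsto_const] by auto
  qed
  have T_add: "T (r + s) = T r \<circ> T s" if r: "0 \<le> r" and s: "0 \<le> s" for r s
  proof
    fix x
    \<comment> \<open>The floor of a sum exceeds the sum of the floors by \<open>0\<close> or
      \<open>1\<close>, so the extra steps last at most \<open>\<tau> n\<close>.\<close>
    define d where "d n = N (r + s) n - (N r n + N s n)" for n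
    have le: "N r n + N s n \<le> N (r + s) n" "d n \<le> 1" for n
    proof -
      have "real n * ((r + s) / t) = real n * (r / t) + real n * (s / t)"
        by (simp add: add_divide_distrib distrib_left)
      moreover have "0 \<le> real n * (r / t)" "0 \<le> real n * (s / t)" using r s t by simp_all
      ultimately show "N r n + N s n \<le> N (r + s) n" "d n \<le> 1"
        unfolding d_def N_def by linarith+
    qed
    have d0: "((\<lambda>n. real (d n) * \<tau> n) \<longlongrightarrow> 0) H"
    proof (rule tendsto_0_le[OF \<tau>0])
      show "\<forall>\<^sub>F n in H. norm (real (d n) * \<tau> n) \<le> norm (\<tau> n) * 1"
        using le(2) by (intro always_eventually allI) (simp add: abs_mult mult_left_le_one_le)
    qed
    have "\<forall>\<^sub>F n in H. real (N r n + N s n) * \<tau> n \<le> r + s"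
      using N(1)[OF r] N(1)[OF s] by eventually_elim (simp add: distrib_right)
    then have "((\<lambda>n. (F (\<tau> n) ^^ (N r n + N s n)) ((F (\<tau> n) ^^ d n) x - x)) \<longlongrightarrow> 0) H"
      by (intro pow_tendsto_zero[OF pos] displacement_tendsto \<tau> d0)
    moreover have "((\<lambda>n. (F (\<tau> n) ^^ N r n) (U s n x - T s x)) \<longlongrightarrow> 0) H"
      using lim[OF s, of x] by (intro pow_tendsto_zero[OF pos N(1)[OF r]]) (simp add: Lim_null[symmetric])
    \<comment> \<open>Three summands make up \<open>U (r + s) n x\<close>: the effect of the extra
      step, the replacement of \<open>U s n x\<close> by its limit under a stable power, and
      \<open>U r n\<close> at a fixed vector.\<close>
    ultimately have "((\<lambda>n. (F (\<tau> n) ^^ (N r n + N s n)) ((F (\<tau> n) ^^ d n) x - x)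
        + (F (\<tau> n) ^^ N r n) (U s n x - T s x) + U r n (T s x)) \<longlongrightarrow> 0 + 0 + T r (T s x)) H"
      by (intro tendsto_intros lim[OF r])
    moreover have "\<forall>\<^sub>F n in H. (F (\<tau> n) ^^ (N r n + N s n)) ((F (\<tau> n) ^^ d n) x - x)
        + (F (\<tau> n) ^^ N r n) (U s n x - T s x) + U r n (T s x) = U (r + s) n x"
      using pos
    proof eventually_elim
      case (elim n)
      have "U (r + s) n = F (\<tau> n) ^^ ((N r n + N s n) + d n)"
        using le(1)[of n] by (simp add: U_def d_def)
      then have "U (r + s) n x = (F (\<tau> n) ^^ (N r n + N s n)) ((F (\<tau> n) ^^ d n) x)"
        by (simp only: funpow_add comp_apply)
      then show ?case using elim by (simp add: pow_diff U_def funpow_add)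
    qed
    ultimately have "((\<lambda>n. U (r + s) n x) \<longlongrightarrow> 0 + 0 + T r (T s x)) H"
      by (rule Lim_transform_eventually)
    then show "T (r + s) x = (T r \<circ> T s) x"
      using tendsto_unique[OF H(2) lim] r s by simp
  qed
  have T_consistent: "((\<lambda>h. (T h x - x) /\<^sub>R h) \<longlongrightarrow> Z x) (at_right 0)" if x: "x \<in> D" for x
  proof (rule tendsto_slope)
    fix e :: real assume e: "e > 0"
    have xZ: "(x, Z x) \<in> closure (operator_graph D Z)"
      using x by (rule graph_in_closure)
    show "\<forall>\<^sub>F h in at_right 0. norm (T h x - x - h *\<^sub>R Z x) \<le> e * h"
      using equicontinuous[OF e, of "Z x"] eventually_at_right_less[of 0]
    proof eventually_elim
      case (elim h)
      then have h: "0 \<le> h" by simp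
      show ?case
      proof (rule field_le_epsilon)
        fix e' :: real assume "e' > 0"
        then have "\<forall>\<^sub>F n in H. norm (U h n x - x - h *\<^sub>R Z x) \<le> e * h + e'"
          unfolding U_def using elim
          by (intro graph_increment_limit[OF xZ h _ _ \<tau> N(1)[OF h] N(2)[OF h]]) auto
        then show "norm (T h x - x - h *\<^sub>R Z x) \<le> e * h + e'"
          by (rule tendsto_upperbound[rotated, OF _ H(2)]) (intro tendsto_intros lim h)
      qed
    qed
  qed
  have "stable_semigroup T D Z"
  proof (intro stable_semigroup.intro stable_family.intro stable_semigroup_axioms.intro)
    fix S
    obtain K where K: "K \<ge> 1" "\<And>s x. s \<in> {0..S} \<Longrightarrow> norm (T s x) \<le> K * norm x"
      using T_bound[of S] by blast
    then show "\<exists>K\<ge>1. \<forall>\<tau>>0. \<forall>m x. real m * \<tau> \<le> S \<longrightarrow> norm ((T \<tau> ^^ m) x) \<le> K * norm x"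
      by (intro exI[of _ K]) (simp add: semigroup_funpow[OF T_zero T_add])
  qed (use T_lin T_consistent dense T_zero T_add in auto)
  then show ?thesis using lim by (intro exI[of _ T]) (simp add: U_def N_def \<tau>_def)
qed

end

section \<open>Generators and the class of approximating families\<close>

lemma closure_real_subspace:
  fixes V :: "'v::real_normed_vector set"
  assumes "subspace V"
  shows "subspace (closure V)"
proof (rule subspaceI)
  show "0 \<in> closure V" using subspace_0[OF assms] closure_subset by blast
next
  fix x y assume "x \<in> closure V" "y \<in> closure V"
  then obtain u v where "\<And>n. u n \<in> V" "u \<longlonglongrightarrow> x" "\<And>n. v n \<in> V" "v \<longlonglongrightarrow> y"
    unfolding closure_sequential by blast
  then show "x + y \<in> closure V"
    unfolding closure_sequential
    by (intro exI[of _ "\<lambda>n. u n + v n"]) (auto intro: tendsto_add subspace_add[OF assms])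
next
  fix x and c :: real assume "x \<in> closure V"
  then obtain u where "\<And>n. u n \<in> V" "u \<longlonglongrightarrow> x" unfolding closure_sequential by blast
  then show "c *\<^sub>R x \<in> closure V"
    unfolding closure_sequential
    by (intro exI[of _ "\<lambda>n. c *\<^sub>R u n"]) (auto intro: tendsto_scaleR subspace_scale[OF assms])
qed

lemma deriv0_eqI:
  "((\<lambda>h. (S h x - S 0 x) /\<^sub>R h) \<longlongrightarrow> y) (at_right 0) \<Longrightarrow> x \<in> deriv0_domain S \<and> deriv0 S x = y"
  unfolding deriv0_domain_def deriv0_def using tendsto_Lim[OF trivial_limit_at_right_real] by blast

lemma deriv0_tendsto:
  "x \<in> deriv0_domain S \<Longrightarrow> ((\<lambda>h. (S h x - S 0 x) /\<^sub>R h) \<longlongrightarrow> deriv0 S x) (at_right 0)"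
  using deriv0_eqI by (force simp: deriv0_domain_def)

text \<open>Bridge from the encoding by domain and function to pairs \<open>(x, y)\<close> with a
  convergent difference quotient, in which the estimates are phrased.\<close>

lemma deriv0_graph_iff:
  assumes "S 0 = id"
  shows "(x, y) \<in> operator_graph (deriv0_domain S) (deriv0 S) \<longleftrightarrow>
           ((\<lambda>h. (S h x - x) /\<^sub>R h) \<longlongrightarrow> y) (at_right 0)"
  using deriv0_eqI[of S x y] deriv0_tendsto[of x S] assms by (auto simp: operator_graph_def)

lemma (in banach_space_over) scaleR_smul_commute: "smul c (r *\<^sub>R x) = r *\<^sub>R smul c x"
  unfolding scale_of_real[symmetric] by (rule scale_left_commute)

lemma (in banach_space_over) bounded_linear_smul: "bounded_linear (smul c)"
  by (rule bounded_linear_intro[where K = "norm c"])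
    (simp_all add: scale_right_distrib scaleR_smul_commute norm_scale mult.commute)

lemma linear_operator_generator:
  assumes "banach_space_over smul" and T: "C0_semigroup smul T"
  shows "linear_operator smul (deriv0_domain T) (deriv0 T)"
proof -
  interpret banach_space_over smul by fact
  have lin: "T h (x + y) = T h x + T h y" "T h (smul c x) = smul c (T h x)" if "0 \<le> h" for h x y c
    using T that
    by (auto simp: C0_semigroup_def bounded_operator_def Vector_Spaces.linear_def module_hom_iff)
  have *: "x + y \<in> deriv0_domain T \<and> deriv0 T (x + y) = deriv0 T x + deriv0 T y"
    if "x \<in> deriv0_domain T" "y \<in> deriv0_domain T" for x y
  proof -
    have "\<forall>\<^sub>F h in at_right 0. (T h x - T 0 x) /\<^sub>R h + (T h y - T 0 y) /\<^sub>R h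
        = (T h (x + y) - T 0 (x + y)) /\<^sub>R h"
      using eventually_at_right_less[of 0] by eventually_elim (simp add: lin algebra_simps)
    from Lim_transform_eventually[OF tendsto_add[OF that[THEN deriv0_tendsto]] this]
    show ?thesis by (rule deriv0_eqI)
  qed
  have **: "smul c x \<in> deriv0_domain T \<and> deriv0 T (smul c x) = smul c (deriv0 T x)"
    if "x \<in> deriv0_domain T" for x c
  proof -
    interpret C: bounded_linear "smul c" by (rule bounded_linear_smul)
    have "\<forall>\<^sub>F h in at_right 0. smul c ((T h x - T 0 x) /\<^sub>R h)
        = (T h (smul c x) - T 0 (smul c x)) /\<^sub>R h"
      using eventually_at_right_less[of 0] by eventually_elim (simp add: lin C.diff C.scaleR)
    from Lim_transform_eventually[OF C.tendsto[OF deriv0_tendsto[OF that]] this]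
    show ?thesis by (rule deriv0_eqI)
  qed
  have "\<forall>\<^sub>F h in at_right 0. 0 = (T h 0 - T 0 0) /\<^sub>R h"
    using eventually_at_right_less[of 0]
  proof eventually_elim
    case (elim h)
    then show ?case using lin(2)[of h 0 0] lin(2)[of 0 0 0] by simp
  qed
  from Lim_transform_eventually[OF tendsto_const this] have "0 \<in> deriv0_domain T"
    using deriv0_eqI by blast
  then show ?thesis unfolding linear_operator_def using * ** by (auto intro: subspaceI)
qed

text \<open>Riemann sums use real scalars, and the product space is taken with its real structure,
  so homogeneity over \<open>'k\<close> is specialised to \<open>of_real r\<close>.\<close>

lemma subspace_operator_graph:
  assumes "banach_space_over smul" "linear_operator smul D Z"
  shows "Real_Vector_Spaces.subspace (operator_graph D Z)"
proof -
  interpret banach_space_over smul by fact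
  have D: "subspace D" and add: "\<And>x y. x \<in> D \<Longrightarrow> y \<in> D \<Longrightarrow> Z (x + y) = Z x + Z y"
    and scale: "\<And>c x. x \<in> D \<Longrightarrow> Z (smul c x) = smul c (Z x)"
    using assms(2) by (auto simp: linear_operator_def)
  have "0 \<in> D" "Z 0 = 0" using subspace_0[OF D] scale[of 0 0] by auto
  moreover have "r *\<^sub>R x \<in> D" "Z (r *\<^sub>R x) = r *\<^sub>R Z x" if "x \<in> D" for r x
    using subspace_scale[OF D that, of "of_real r"] scale[OF that, of "of_real r"]
    by (simp_all add: scale_of_real)
  ultimately show ?thesis
    using subspace_add[OF D] add
    by (intro Real_Vector_Spaces.subspaceI) (auto simp: operator_graph_def zero_prod_def)
qed

section \<open>Stability of semigroups and of the approximating families\<close>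

text \<open>Otherwise there are times \<open>s n\<close> tending to zero and vectors
  \<open>v n\<close> with growth factors beyond \<open>n + 1\<close>; yet \<open>T (s n) x\<close>
  tends to \<open>x\<close> for every \<open>x\<close>, so uniform boundedness gives a
  contradiction.\<close>

lemma semigroup_locally_bounded:
  assumes T: "C0_semigroup smul T"
  shows "\<exists>\<eta>>0. \<exists>C\<ge>1. \<forall>s\<in>{0..\<eta>}. \<forall>x. norm (T s x) \<le> C * norm x"
proof (rule ccontr)
  assume neg: "\<not> ?thesis"
  have unbounded: "\<exists>s\<in>{0..\<eta>}. \<exists>x. norm (T s x) > C * norm x" if "0 < \<eta>" "1 \<le> C" for \<eta> C
  proof (rule ccontr)
    assume "\<not> (\<exists>s\<in>{0..\<eta>}. \<exists>x. norm (T s x) > C * norm x)"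
    then have "\<forall>s\<in>{0..\<eta>}. \<forall>x. norm (T s x) \<le> C * norm x" by (simp only: bex_simps not_ex not_less)
    with that have "\<exists>\<eta>>0. \<exists>C\<ge>1. \<forall>s\<in>{0..\<eta>}. \<forall>x. norm (T s x) \<le> C * norm x"
      by (intro exI[of _ \<eta>] exI[of _ C] conjI)
    with neg show False by (rule notE)
  qed
  \<comment> \<open>Time and vector are packed into one pair, so that a single choice over
    \<open>n\<close> suffices.\<close>
  have "\<exists>q. fst q \<in> {0..inverse (real (Suc n))} \<and>
      norm (T (fst q) (snd q)) > real (Suc n) * norm (snd q)" for n
  proof -
    have "inverse (real (Suc n)) > 0" "real (Suc n) \<ge> 1" by simp_all
    then obtain s x where "s \<in> {0..inverse (real (Suc n))}" "norm (T s x) > real (Suc n) * norm x"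
      using unbounded by blast
    then show ?thesis by (intro exI[of _ "(s, x)"]) simp
  qed
  then have "\<exists>q. \<forall>n. fst (q n) \<in> {0..inverse (real (Suc n))} \<and>
      norm (T (fst (q n)) (snd (q n))) > real (Suc n) * norm (snd (q n))"
    by (intro choice allI)
  then obtain q where q: "\<And>n. fst (q n) \<in> {0..inverse (real (Suc n))}"
      "\<And>n. norm (T (fst (q n)) (snd (q n))) > real (Suc n) * norm (snd (q n))"
    by blast
  define s where "s n = fst (q n)" for n
  define v where "v n = snd (q n)" for n
  have s: "s n \<in> {0..inverse (real (Suc n))}" and v: "norm (T (s n) (v n)) > real (Suc n) * norm (v n)" for n
    using q[of n] by (simp_all add: s_def v_def)
  have s0: "s \<longlonglongrightarrow> 0"
    by (rule tendsto_sandwich[OF _ _ tendsto_const LIMSEQ_inverse_real_of_nat])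
      (use s in \<open>auto simp del: of_nat_Suc\<close>)
  have lim: "(\<lambda>n. T (s n) x) \<longlonglongrightarrow> x" for x
  proof (rule tendstoI)
    fix e :: real assume e: "e > 0"
    have "((\<lambda>s. T s x) \<longlongrightarrow> x) (at_right 0)" using T by (simp add: C0_semigroup_def)
    from tendstoD[OF this e] obtain b where b: "b > 0" "\<And>r. 0 < r \<Longrightarrow> r < b \<Longrightarrow> dist (T r x) x < e"
      unfolding eventually_at_right_field by auto
    show "\<forall>\<^sub>F n in sequentially. dist (T (s n) x) x < e"
      using order_tendstoD(2)[OF s0 b(1)]
    proof eventually_elim
      case (elim n)
      have "T 0 x = x" using T by (simp add: C0_semigroup_def)
      then show ?case using b(2)[of "s n"] elim s[of n] e by (cases "s n = 0") auto
    qed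
  qed
  have "\<exists>C. \<forall>n x. norm (T (s n) x) \<le> C * norm x"
  proof (rule uniform_boundedness)
    show "bounded_linear (T (s n))" for n
      using T s[of n] by (simp add: C0_semigroup_def bounded_operator_def)
    show "\<exists>c. \<forall>n. norm (T (s n) x) \<le> c" for x
      using convergent_imp_Bseq[of "\<lambda>n. T (s n) x"] lim[of x] unfolding convergent_def Bseq_def by blast
  qed
  then obtain C where C: "\<And>n x. norm (T (s n) x) \<le> C * norm x" by blast
  obtain n where n: "C < real n" using reals_Archimedean2 by blast
  have "C * norm (v n) \<le> real (Suc n) * norm (v n)" using n by (intro mult_right_mono) auto
  then show False using C[of n "v n"] v[of n] by linarith
qed

text \<open>Cutting the time into \<open>k\<close> pieces no longer than \<eta> gives the bound
  \<open>C ^ k\<close> by the semigroup law; \<open>max S 0\<close> covers negative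
  horizons.\<close>

lemma C0_semigroup_stable:
  assumes T: "C0_semigroup smul T"
    and consistent: "\<And>x. x \<in> D \<Longrightarrow> ((\<lambda>h. (T h x - x) /\<^sub>R h) \<longlongrightarrow> Z x) (at_right 0)"
    and dense: "closure D = UNIV"
  shows "stable_semigroup T D Z"
proof (intro stable_semigroup.intro stable_family.intro stable_semigroup_axioms.intro)
  have T_zero: "T 0 = id" and T_add: "\<And>r s. 0 \<le> r \<Longrightarrow> 0 \<le> s \<Longrightarrow> T (r + s) = T r \<circ> T s"
    using T by (simp_all add: C0_semigroup_def)
  then show "T 0 = id" "\<And>r s. 0 \<le> r \<Longrightarrow> 0 \<le> s \<Longrightarrow> T (r + s) = T r \<circ> T s" by blast+
  fix S
  obtain \<eta> C where \<eta>: "\<eta> > 0" and C: "C \<ge> 1"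
    "\<And>s x. s \<in> {0..\<eta>} \<Longrightarrow> norm (T s x) \<le> C * norm x"
    using semigroup_locally_bounded[OF T] by blast
  obtain k :: nat where k: "real k > max S 0 / \<eta>" using reals_Archimedean2 by blast
  have "max S 0 / \<eta> \<ge> 0" using \<eta> by simp
  then have k0: "real k > 0" using k by linarith
  have "norm (T s x) \<le> C ^ k * norm x" if s: "0 \<le> s" "s \<le> S" for s x
  proof -
    have "s \<le> real k * \<eta>" using k s \<eta> by (simp add: pos_divide_less_eq)
    then have r: "s / real k \<in> {0..\<eta>}" using s k0 by (simp add: pos_divide_le_eq mult.commute)
    have "norm ((T (s / real k) ^^ m) x) \<le> C ^ m * norm x" for m
    proof (induction m)
      case (Suc m)
      have "norm (T (s / real k) ((T (s / real k) ^^ m) x)) \<le> C * norm ((T (s / real k) ^^ m) x)"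
        using C(2)[OF r] .
      also have "\<dots> \<le> C * (C ^ m * norm x)" using Suc C(1) by (intro mult_left_mono) auto
      finally show ?case by (simp add: mult.assoc)
    qed simp
    moreover have "T (s / real k) ^^ k = T s"
      using semigroup_funpow[OF T_zero T_add, of "s / real k" k] r k0 by simp
    ultimately show ?thesis by metis
  qed
  then show "\<exists>K\<ge>1. \<forall>\<tau>>0. \<forall>m x. real m * \<tau> \<le> S \<longrightarrow> norm ((T \<tau> ^^ m) x) \<le> K * norm x"
    using C(1) by (intro exI[of _ "C ^ k"]) (simp add: semigroup_funpow[OF T_zero T_add] one_le_power)
next
  show "bounded_linear (T \<tau>)" if "0 < \<tau>" for \<tau>
    using T that by (simp add: C0_semigroup_def bounded_operator_def)
qed (fact consistent dense)+

text \<open>At \<open>n = 1\<close> and \<open>s = \<tau>\<close> the growth bound depends on the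
  elapsed time \<open>real m * \<tau>\<close> alone, so it is uniform up to the horizon. The
  absolute values in \<open>K\<close> cover either sign of \<open>a\<close> and
  \<open>S\<close>.\<close>

lemma F_class_stable_family:
  assumes F: "F \<in> F_class smul" and D: "D \<subseteq> deriv0_domain F" "\<forall>f\<in>D. deriv0 F f = Z f"
    and dense: "closure D = UNIV"
  shows "stable_family F D Z"
proof (rule stable_family.intro)
  have F0: "F 0 = id" and lin: "\<And>s. 0 \<le> s \<Longrightarrow> bounded_linear (F s)"
    using F by (auto simp: F_class_def bounded_operator_def)
  obtain M a where M: "M \<ge> 1" and Ma: "\<And>n m s. n \<ge> 1 \<Longrightarrow> m \<ge> 1 \<Longrightarrow> s \<ge> 0 \<Longrightarrow>
      onorm (F (s / real n) ^^ m) \<le> M * exp (a * real m / real n * s)"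
    using F unfolding F_class_def mem_Collect_eq by blast
  show "bounded_linear (F \<tau>)" if "0 < \<tau>" for \<tau> using lin that by simp
  show "((\<lambda>\<tau>. (F \<tau> x - x) /\<^sub>R \<tau>) \<longlongrightarrow> Z x) (at_right 0)" if "x \<in> D" for x
    using deriv0_tendsto[of x F] D that by (auto simp: F0)
  show "closure D = UNIV" by (rule dense)
  fix S :: real
  define K where "K = M * exp (\<bar>a\<bar> * \<bar>S\<bar>)"
  have K: "K \<ge> 1" unfolding K_def using M mult_mono[of 1 M 1 "exp (\<bar>a\<bar> * \<bar>S\<bar>)"] by simp
  have "norm ((F \<tau> ^^ m) x) \<le> K * norm x" if \<tau>: "0 < \<tau>" "real m * \<tau> \<le> S" for \<tau> m x
  proof (cases "m = 0")
    \<comment> \<open>The bound of the class starts at \<open>m = 1\<close>; the identity is covered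
      by \<open>K \<ge> 1\<close>.\<close>
    case True
    then show ?thesis using K mult_right_mono[of 1 K "norm x"] by simp
  next
    case False
    have "a * (real m * \<tau>) \<le> \<bar>a\<bar> * \<bar>S\<bar>"
      using \<tau> by (intro mult_mono) auto
    then have "M * exp (a * real m / real 1 * \<tau>) \<le> K"
      unfolding K_def using M by (simp add: mult.assoc)
    then have "onorm (F \<tau> ^^ m) \<le> K" using Ma[of 1 m \<tau>] False \<tau> by simp
    have "norm ((F \<tau> ^^ m) x) \<le> onorm (F \<tau> ^^ m) * norm x"
      using \<tau> by (intro onorm bounded_linear_funpow lin) simp
    also have "\<dots> \<le> K * norm x" using \<open>onorm (F \<tau> ^^ m) \<le> K\<close> by (rule mult_right_mono) simp
    finally show ?thesis .
  qed
  then show "\<exists>K\<ge>1. \<forall>\<tau>>0. \<forall>m x. real m * \<tau> \<le> S \<longrightarrow> norm ((F \<tau> ^^ m) x) \<le> K * norm x"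
    using K by blast
qed

text \<open>The locale sees only the real structure, so homogeneity over \<open>'k\<close> enters as
  a premise. Strong continuity is the estimate near zero.\<close>

lemma stable_semigroup_C0:
  assumes "stable_semigroup T D Z" "banach_space_over smul"
    and smul_T: "\<And>s c x. 0 \<le> s \<Longrightarrow> T s (smul c x) = smul c (T s x)"
  shows "C0_semigroup smul T"
proof -
  interpret banach_space_over smul by fact
  interpret T: stable_semigroup T D Z by fact
  have "bounded_operator smul (T s)" if "0 \<le> s" for s
  proof -
    interpret bounded_linear "T s" using that by (rule T.lin0)
    show ?thesis
      unfolding bounded_operator_def Vector_Spaces.linear_def module_hom_iff
      using bounded_linear_axioms vector_space_axioms module_axioms smul_T[OF that] by (simp add: add)
  qed
  moreover have "((\<lambda>s. T s x) \<longlongrightarrow> x) (at_right 0)" for x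
  proof (rule tendstoI)
    fix e :: real assume e: "e > 0"
    then have "e / 2 > 0" by simp
    from T.near_zero[OF this, of x] eventually_at_right_less[of 0]
    show "\<forall>\<^sub>F s in at_right 0. dist (T s x) x < e"
    proof eventually_elim
      case (elim s)
      then have "norm (T s x - x) \<le> e / 2" by simp
      then show ?case using e by (simp add: dist_norm)
    qed
  qed
  ultimately show ?thesis unfolding C0_semigroup_def using T.T_zero T.T_add by simp
qed

section \<open>The equivalence\<close>

text \<open>Direct implication with \<open>A = D\<close>: the orbit of \<open>f\<close> stays in the
  domain of the generator, so Chernoff's formula gives the limit \<open>T (t * s) f\<close>. This
  limit and its image under the generator are approximated within the graph of \<open>Z\<close>, and
  convergence of both components gives precompactness.\<close>

lemma product_formula_compactness:
  assumes D: "closure D = UNIV" and t: "t > 0"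
    and F: "stable_family F D Z"
    and gen: "C0_semigroup smul T"
      "closure (operator_graph D Z) = operator_graph (deriv0_domain T) (deriv0 T)"
    and f: "f \<in> D" and s: "s \<ge> 0"
  obtains g :: "nat \<Rightarrow> 'x::banach" where "\<And>n. g n \<in> D"
    "(\<lambda>n. norm ((F (t / real n) ^^ nat \<lfloor>real n * s\<rfloor>) f - g n)) \<longlonglongrightarrow> 0"
    "compact (closure ((\<lambda>n. Z (g n)) ` {1..}))" "compact (closure (g ` {1..}))"
proof -
  have T0: "T 0 = id" using gen(1) by (simp add: C0_semigroup_def)
  have graph: "(x, y) \<in> closure (operator_graph D Z) \<longleftrightarrow>
      ((\<lambda>h. (T h x - x) /\<^sub>R h) \<longlongrightarrow> y) (at_right 0)" for x y
    unfolding gen(2) by (rule deriv0_graph_iff) (rule T0)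
  have slope: "((\<lambda>h. (T h x - x) /\<^sub>R h) \<longlongrightarrow> Z x) (at_right 0)" if "x \<in> D" for x
    using graph_in_closure[OF that, where Z = Z] by (simp only: graph)
  interpret T: stable_semigroup T D Z
    using gen(1) slope D by (rule C0_semigroup_stable)
  have orbit: "(T r f, T r (Z f)) \<in> closure (operator_graph D Z)" if "0 \<le> r" for r
    using T.orbit_generator[OF slope[OF f] that] by (simp add: graph)
  have S: "0 \<le> t * s" using t s by simp
  have lim: "(\<lambda>n. (F (t / real n) ^^ nat \<lfloor>real n * s\<rfloor>) f) \<longlonglongrightarrow> T (t * s) f"
    using T.chernoff_product_formula[OF F orbit filterlim_divide_of_nat[OF t]
        floor_multiple_tendsto[OF t S] S] t by simp
  obtain p where p: "\<And>n. p n \<in> operator_graph D Z" "p \<longlonglongrightarrow> (T (t * s) f, T (t * s) (Z f))"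
    using orbit[OF S] unfolding closure_sequential by blast
  define g where "g n = fst (p n)" for n
  have g: "g n \<in> D" "Z (g n) = snd (p n)" for n
    using p(1)[of n] by (auto simp: g_def operator_graph_def)
  have g_lim: "g \<longlonglongrightarrow> T (t * s) f" "(\<lambda>n. Z (g n)) \<longlonglongrightarrow> T (t * s) (Z f)"
    using tendsto_fst[OF p(2)] tendsto_snd[OF p(2)] by (simp_all add: g(2)) (simp add: g_def[abs_def])
  show ?thesis
  proof (rule that[OF g(1)])
    show "(\<lambda>n. norm ((F (t / real n) ^^ nat \<lfloor>real n * s\<rfloor>) f - g n)) \<longlonglongrightarrow> 0"
      using tendsto_norm[OF tendsto_diff[OF lim g_lim(1)]] by simp
  qed (rule compact_closure_convergent[OF g_lim(2)] compact_closure_convergent[OF g_lim(1)])+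
qed

text \<open>Converse: precompactness becomes convergence along one filter \<open>H\<close> for all
  \<open>f\<close> and \<open>s\<close> at once, which produces the semigroup. The limits of the
  pairs \<open>(g f s n, Z (g f s n))\<close> place the orbits in the closed graph, and Riemann sums
  then exhaust the generator.\<close>

lemma compactness_generator:
  assumes ban: "banach_space_over smul" and Z: "linear_operator smul D Z" and t: "t > 0"
    and F: "stable_family F D Z"
    and smul_F: "\<And>s c x. 0 \<le> s \<Longrightarrow> F s (smul c x) = smul c (F s x)"
    and A: "A \<subseteq> D" "closure A = UNIV"
    and g: "\<And>f s n. f \<in> A \<Longrightarrow> 0 \<le> s \<Longrightarrow> 1 \<le> n \<Longrightarrow> g f s n \<in> D"
      "\<And>f s. f \<in> A \<Longrightarrow> 0 \<le> s \<Longrightarrow>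
         (\<lambda>n. norm ((F (t / real n) ^^ nat \<lfloor>real n * s\<rfloor>) f - g f s n)) \<longlonglongrightarrow> 0"
      "\<And>f s. f \<in> A \<Longrightarrow> 0 \<le> s \<Longrightarrow> compact (closure ((\<lambda>n. Z (g f s n)) ` {1..}))"
      "\<And>f s. f \<in> A \<Longrightarrow> 0 \<le> s \<Longrightarrow> compact (closure (g f s ` {1..}))"
  shows "\<exists>T. C0_semigroup smul T \<and>
    closure (operator_graph D Z) = operator_graph (deriv0_domain T) (deriv0 T)"
proof -
  interpret banach_space_over smul by (rule ban)
  interpret F: stable_family F D Z by (rule F)
  \<comment> \<open>Approximants and their images are paired and indexed by \<open>(f, s)\<close>;
    the default \<open>(0, 0)\<close> keeps the family total and every factor compact.\<close>
  define p where "p n = (\<lambda>(f, s). if f \<in> A \<and> 0 \<le> s then (g f s n, Z (g f s n)) else (0, 0))" for n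
  define K where "K = (\<lambda>(f, s). if f \<in> A \<and> 0 \<le> s
      then closure (g f s ` {1..}) \<times> closure ((\<lambda>n. Z (g f s n)) ` {1..}) else {(0, 0)})"
  have "compact (K i)" for i
    using g(3,4) by (auto simp: K_def split: prod.split intro: compact_Times)
  moreover have "\<forall>\<^sub>F n in sequentially. \<forall>i. p n i \<in> K i"
    using eventually_ge_at_top[of 1]
  proof eventually_elim
    case (elim n)
    then show ?case
      by (auto simp: p_def K_def intro!: subsetD[OF closure_subset] imageI)
  qed
  ultimately obtain H where H: "H \<le> sequentially" "H \<noteq> bot"
    and p_lim: "\<And>i. \<exists>l. ((\<lambda>n. p n i) \<longlongrightarrow> l) H"
    using pointwise_convergent_subfilter[OF sequentially_bot, of K p] by blast
  have ev: "\<forall>\<^sub>F n in H. 1 \<le> n"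
    using H(1) eventually_ge_at_top by (rule filter_leD)
  \<comment> \<open>Condition (a) is read at parameter \<open>s / t\<close>, so that the limit sits
    at time \<open>s\<close>; it gives the powers the same limit as the approximants.\<close>
  have lims: "\<exists>x y. ((\<lambda>n. g f (s / t) n) \<longlongrightarrow> x) H \<and> ((\<lambda>n. Z (g f (s / t) n)) \<longlongrightarrow> y) H \<and>
      ((\<lambda>n. (F (t / real n) ^^ nat \<lfloor>real n * (s / t)\<rfloor>) f) \<longlongrightarrow> x) H"
    if f: "f \<in> A" and s: "0 \<le> s" for f s
  proof -
    have st: "0 \<le> s / t" using s t by simp
    obtain l where "((\<lambda>n. p n (f, s / t)) \<longlongrightarrow> l) H" using p_lim by blast
    then have l: "((\<lambda>n. (g f (s / t) n, Z (g f (s / t) n))) \<longlongrightarrow> l) H"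
      using f st by (simp add: p_def)
    have 1: "((\<lambda>n. g f (s / t) n) \<longlongrightarrow> fst l) H" "((\<lambda>n. Z (g f (s / t) n)) \<longlongrightarrow> snd l) H"
      using tendsto_fst[OF l] tendsto_snd[OF l] by simp_all
    have "((\<lambda>n. (F (t / real n) ^^ nat \<lfloor>real n * (s / t)\<rfloor>) f - g f (s / t) n) \<longlongrightarrow> 0) H"
      using filterlim_mono[OF g(2)[OF f st] order_refl H(1)] by (rule tendsto_norm_zero_cancel)
    from tendsto_add[OF this 1(1)] 1 show ?thesis by auto
  qed
  then have "\<exists>l. ((\<lambda>n. (F (t / real n) ^^ nat \<lfloor>real n * (s / t)\<rfloor>) f) \<longlongrightarrow> l) H"
    if "f \<in> A" "0 \<le> s" for f s
    using that by blast
  from F.limit_semigroup[OF t H A(2) this]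
  obtain T where T: "stable_semigroup T D Z"
    and lim: "\<forall>s\<ge>0. \<forall>x. ((\<lambda>n. (F (t / real n) ^^ nat \<lfloor>real n * (s / t)\<rfloor>) x) \<longlongrightarrow> T s x) H"
    by blast
  note T_lim = lim[rule_format]
  interpret T: stable_semigroup T D Z by (rule T)
  have smul_T: "T s (smul c x) = smul c (T s x)" if s: "0 \<le> s" for s c x
  proof (rule tendsto_unique[OF H(2) T_lim[OF s]])
    interpret C: bounded_linear "smul c" by (rule bounded_linear_smul)
    have "(F (t / real n) ^^ m) (smul c x) = smul c ((F (t / real n) ^^ m) x)" for n m
      using t by (induction m) (simp_all add: smul_F)
    then show "((\<lambda>n. (F (t / real n) ^^ nat \<lfloor>real n * (s / t)\<rfloor>) (smul c x)) \<longlongrightarrow> smul c (T s x)) H"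
      using C.tendsto[OF T_lim[OF s]] by simp
  qed
  have C0: "C0_semigroup smul T" using T ban smul_T by (rule stable_semigroup_C0)
  \<comment> \<open>The closed graph contains the limit pair. Its first entry is
    \<open>T s f\<close> by (a), and uniqueness of the derivative along the orbit identifies the
    second as \<open>T s (Z f)\<close>.\<close>
  have invariant: "(T s f, T s (Z f)) \<in> closure (operator_graph D Z)" if f: "f \<in> A" and s: "0 \<le> s" for f s
  proof -
    obtain x y where xy: "((\<lambda>n. g f (s / t) n) \<longlongrightarrow> x) H" "((\<lambda>n. Z (g f (s / t) n)) \<longlongrightarrow> y) H"
      "((\<lambda>n. (F (t / real n) ^^ nat \<lfloor>real n * (s / t)\<rfloor>) f) \<longlongrightarrow> x) H"
      using lims[OF f s] by blast
    have x: "x = T s f" using tendsto_unique[OF H(2) xy(3) T_lim[OF s]] .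
    have graph: "(x, y) \<in> closure (operator_graph D Z)"
    proof (rule Lim_in_closed_set[OF closed_closure _ H(2) tendsto_Pair[OF xy(1,2)]])
      show "\<forall>\<^sub>F n in H. (g f (s / t) n, Z (g f (s / t) n)) \<in> closure (operator_graph D Z)"
        using ev
      proof eventually_elim
        case (elim n)
        then have "g f (s / t) n \<in> D" using g(1)[OF f, of "s / t"] s t by simp
        then show ?case by (rule graph_in_closure)
      qed
    qed
    have "((\<lambda>h. (T h (T s f) - T s f) /\<^sub>R h) \<longlongrightarrow> T s (Z f)) (at_right 0)"
      using T.orbit_generator[OF T.consistent s] f A(1) by blast
    then have "y = T s (Z f)"
      using tendsto_unique[OF trivial_limit_at_right_real T.closure_graph_generator[OF graph]] x by simp
    then show ?thesis using graph x by simp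
  qed
  have "(x, y) \<in> closure (operator_graph D Z)"
    if "((\<lambda>h. (T h x - x) /\<^sub>R h) \<longlongrightarrow> y) (at_right 0)" for x y
    by (rule T.generator_in_closed_subspace[OF closed_closure
          closure_real_subspace[OF subspace_operator_graph[OF ban Z]] A invariant that])
  then have "(x, y) \<in> closure (operator_graph D Z) \<longleftrightarrow>
      (x, y) \<in> operator_graph (deriv0_domain T) (deriv0 T)" for x y
    unfolding deriv0_graph_iff[of T, OF T.T_zero] using T.closure_graph_generator by blast
  then have "closure (operator_graph D Z) = operator_graph (deriv0_domain T) (deriv0 T)" by auto
  with C0 show ?thesis by blast
qed

theorem theorem5p4:
  fixes smul :: "'k::real_normed_field \<Rightarrow> 'x::banach \<Rightarrow> 'x"
    and D :: "'x set"
    and Z :: "'x \<Rightarrow> 'x"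
    and F :: "real \<Rightarrow> 'x \<Rightarrow> 'x"
    and t :: real
  assumes "banach_space_over smul"
    and "linear_operator smul D Z"
    and "closure D = UNIV"
    and "t > 0"
    and "F \<in> F_class smul"
    and "D \<subseteq> deriv0_domain F"
    and "\<forall>f\<in>D. deriv0 F f = Z f"
  shows "(closable smul D Z \<and>
           (\<exists>D' Z'. is_closure_of D' Z' D Z \<and> is_generator smul D' Z')) \<longleftrightarrow>
         (\<exists>A. module.subspace smul A \<and> A \<subseteq> D \<and> closure A = UNIV \<and>
            (\<forall>f\<in>A. \<forall>s\<ge>0. \<exists>g :: nat \<Rightarrow> 'x.
               (\<forall>n\<ge>1. g n \<in> D) \<and>
               (\<lambda>n. norm ((F (t / real n) ^^ nat \<lfloor>real n * s\<rfloor>) f - g n)) \<longlonglongrightarrow> 0 \<and>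
               compact (closure ((\<lambda>n. Z (g n)) ` {1..})) \<and>
               compact (closure (g ` {1..}))))"
    (is "?L \<longleftrightarrow> ?R")
proof -
  have F: "stable_family F D Z"
    by (rule F_class_stable_family[OF assms(5,6,7,3)])
  show ?thesis
  proof
    assume ?L
    then obtain D' Z' T where closure: "is_closure_of D' Z' D Z"
      and T: "C0_semigroup smul T" "D' = deriv0_domain T" "\<forall>x\<in>D'. Z' x = deriv0 T x"
      unfolding is_generator_def by blast
    \<comment> \<open>Values outside the domain do not enter the graph, so \<open>Z'\<close> may be
      replaced by \<open>deriv0 T\<close>.\<close>
    have "operator_graph D' Z' = operator_graph (deriv0_domain T) (deriv0 T)"
      using T(2,3) by (auto simp: operator_graph_def)
    then have "closure (operator_graph D Z) = operator_graph (deriv0_domain T) (deriv0 T)"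
      using closure by (simp add: is_closure_of_def)
    note * = product_formula_compactness[OF assms(3,4) F T(1) this]
    show ?R
    proof (intro exI[of _ D] conjI ballI allI impI)
      show "module.subspace smul D" using assms(2) by (simp add: linear_operator_def)
    next
      fix f s assume "f \<in> D" "0 \<le> (s :: real)"
      then show "\<exists>g :: nat \<Rightarrow> 'x. (\<forall>n\<ge>1. g n \<in> D) \<and>
               (\<lambda>n. norm ((F (t / real n) ^^ nat \<lfloor>real n * s\<rfloor>) f - g n)) \<longlonglongrightarrow> 0 \<and>
               compact (closure ((\<lambda>n. Z (g n)) ` {1..})) \<and>
               compact (closure (g ` {1..}))"
      proof (rule *)
        fix g assume "\<And>n. g n \<in> D"
          "(\<lambda>n. norm ((F (t / real n) ^^ nat \<lfloor>real n * s\<rfloor>) f - g n)) \<longlonglongrightarrow> 0"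
          "compact (closure ((\<lambda>n. Z (g n)) ` {1..}))" "compact (closure (g ` {1..}))"
        then show ?thesis by (intro exI[of _ g]) simp
      qed
    qed (use assms(3) in auto)
  next
    assume ?R
    \<comment> \<open>The condition on \<open>s\<close> is recast as membership in
      \<open>{0..}\<close> so that bounded choice yields one function \<open>g\<close> of
      \<open>f\<close>, \<open>s\<close> and \<open>n\<close>.\<close>
    then obtain A where A: "A \<subseteq> D" "closure A = UNIV"
      and "\<forall>f\<in>A. \<forall>s\<in>{0..}. \<exists>g :: nat \<Rightarrow> 'x. (\<forall>n\<ge>1. g n \<in> D) \<and>
               (\<lambda>n. norm ((F (t / real n) ^^ nat \<lfloor>real n * s\<rfloor>) f - g n)) \<longlonglongrightarrow> 0 \<and>
               compact (closure ((\<lambda>n. Z (g n)) ` {1..})) \<and>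
               compact (closure (g ` {1..}))"
      by auto
    then obtain g where g: "\<And>f s. f \<in> A \<Longrightarrow> s \<in> {0..} \<Longrightarrow> (\<forall>n\<ge>1. g f s n \<in> D) \<and>
               (\<lambda>n. norm ((F (t / real n) ^^ nat \<lfloor>real n * s\<rfloor>) f - g f s n)) \<longlonglongrightarrow> 0 \<and>
               compact (closure ((\<lambda>n. Z (g f s n)) ` {1..})) \<and>
               compact (closure (g f s ` {1..}))"
      unfolding bchoice_iff by blast
    have smul_F: "F s (smul c x) = smul c (F s x)" if "0 \<le> s" for s c x
      using assms(5) that
      by (simp add: F_class_def bounded_operator_def Vector_Spaces.linear_def module_hom_iff)
    have "\<exists>T. C0_semigroup smul T \<and>
        closure (operator_graph D Z) = operator_graph (deriv0_domain T) (deriv0 T)"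
      by (rule compactness_generator[OF assms(1,2,4) F smul_F A, where g = g]) (use g in auto)
    then obtain T where T: "C0_semigroup smul T"
      "closure (operator_graph D Z) = operator_graph (deriv0_domain T) (deriv0 T)"
      by blast
    then have "is_closure_of (deriv0_domain T) (deriv0 T) D Z" by (simp add: is_closure_of_def)
    moreover have "linear_operator smul (deriv0_domain T) (deriv0 T)"
      using assms(1) T(1) by (rule linear_operator_generator)
    moreover have "is_generator smul (deriv0_domain T) (deriv0 T)"
      using T(1) by (auto simp: is_generator_def)
    ultimately show ?L unfolding closable_def by blast
  qed
qed

end
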